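(* For each $\theta>-1/2$, the random variable $X_{1/2,\theta}\overset{d}{=}G_{\theta+1/2}/G_{1/2}$ satisfies $$X_{1/2,\theta}\overset{d}{=}\beta_{\theta+1/2,1/2}\,X_{1/2,\theta+1/2}\overset{d}{=}M_{1+\theta}\Big(F_{X_{1/2}Y_{\frac{\theta+1/2}{1+\theta}}}\Big).$$ As a consequence, the random variable $G_{1+\theta}X_{1/2,\theta}\overset{d}{=}G_{\theta+1/2}X_{1/2,\theta+1/2}$ is $$\mathrm{GGC}\Big(\theta+1,F_{X_{1/2}Y_{\frac{\theta+1/2}{1+\theta}}}\Big)=\mathrm{GGC}\big(\theta+1/2,F_{X_{1/2}}\big).$$
   Context: $G_a$ denotes a gamma$(a,1)$ random variable and $\beta_{a,b}$ a beta$(a,b)$ random variable; in all products and ratios the factors are independent. $X_{1/2}\overset{d}{=}G_{1/2}/G_{1/2}'$ with $G_{1/2},G_{1/2}'$ i.i.d. gamma$(1/2,1)$, i.e. $X_{1/2}$ has density $\frac1\pi x^{-1/2}(1+x)^{-1}$ on $(0,\infty)$. $Y_\sigma$ denotes a Bernoulli random variable with success probability $\sigma$, independent of $X_{1/2}$. $F_R$ denotes the distribution of $R$. Dirichlet process and Dirichlet mean: for $\theta>0$ and a probability distribution $F$ on $[0,\infty)$, a Dirichlet process $P_\theta$ with total mass $\theta$ and parameter $F$ is a random probability measure on $[0,\infty)$ such that for every finite measurable partition $(C_1,\dots,C_k)$ of $[0,\infty)$ the vector $(P_\theta(C_1),\dots,P_\theta(C_k))$ is Dirichlet distributed with parameters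 $(\theta F(C_1),\dots,\theta F(C_k))$. The Dirichlet mean is $M_\theta(F)\overset{d}{=}\int_0^\infty x\,P_\theta(dx)$. $\mathrm{GGC}(\theta,F)$ denotes the law of $G_\theta M_\theta(F)$, whose Laplace transform is $\exp(-\theta\int_0^\infty\log(1+\lambda x)F(dx))$, $\lambda\ge0$. *)

theory Defs
  imports "HOL-Probability.Probability"
begin

text \<open>
  Distributions are measures on the Borel sets of the reals, and equality in distribution is
  equality of measures. Independence of factors is expressed by the product measure.
\<close>

definition mult_law :: "real measure \<Rightarrow> real measure \<Rightarrow> real measure" where
  "mult_law \<mu> \<nu> = distr (\<mu> \<Otimes>\<^sub>M \<nu>) borel (\<lambda>(x, y). x * y)"

definition ratio_law :: "real measure \<Rightarrow> real measure \<Rightarrow> real measure" where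
  "ratio_law \<mu> \<nu> = distr (\<mu> \<Otimes>\<^sub>M \<nu>) borel (\<lambda>(x, y). x / y)"

text \<open>
  The law of a gamma(a,1) variable. The parameter 0 stands for the point mass at 0; this
  convention only serves to allow zero parameters in the Dirichlet distribution below.
\<close>
definition gamma_law :: "real \<Rightarrow> real measure" where
  "gamma_law a =
    (if 0 < a
     then density lborel
       (\<lambda>x. ennreal (if 0 < x then x powr (a - 1) * exp (- x) / Gamma a else 0))
     else return borel 0)"

definition beta_law :: "real \<Rightarrow> real \<Rightarrow> real measure" where
  "beta_law a b = density lborel
     (\<lambda>x. ennreal (if 0 < x \<and> x < 1
       then x powr (a - 1) * (1 - x) powr (b - 1) / Beta a b else 0))"

definition bernoulli_law :: "real \<Rightarrow> real measure" where
  "bernoulli_law p = distr (measure_pmf (bernoulli_pmf p)) borel (\<lambda>b. of_bool b)"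

text \<open>The law of \<open>X\<^bsub>1/2,\<theta>\<^esub>\<close>, and that of \<open>X\<^bsub>1/2\<^esub> Y\<^bsub>p\<^esub>\<close>.\<close>

definition X_half_law :: "real measure" where
  "X_half_law = ratio_law (gamma_law (1/2)) (gamma_law (1/2))"

definition X_half_param_law :: "real \<Rightarrow> real measure" where
  "X_half_param_law \<theta> = ratio_law (gamma_law (\<theta> + 1/2)) (gamma_law (1/2))"

definition XY_law :: "real \<Rightarrow> real measure" where
  "XY_law p = mult_law X_half_law (bernoulli_law p)"

text \<open>
  The Dirichlet distribution with nonnegative parameters \<open>\<alpha> 0, \<dots>, \<alpha> (k - 1)\<close> (not all
  zero): the law of a vector of independent gamma variables divided by their sum. Coordinates
  whose parameter is 0 vanish almost surely.
\<close>
definition dirichlet_law :: "nat \<Rightarrow> (nat \<Rightarrow> real) \<Rightarrow> (nat \<Rightarrow> real) measure" where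
  "dirichlet_law k \<alpha> =
    distr (\<Pi>\<^sub>M i\<in>{..<k}. gamma_law (\<alpha> i)) (\<Pi>\<^sub>M i\<in>{..<k}. borel)
      (\<lambda>g. \<lambda>i\<in>{..<k}. g i / (\<Sum>j<k. g j))"

text \<open>
  \<open>P\<close>, defined on the probability space \<open>\<Omega>\<close>, is a Dirichlet process on the half line with total
  mass \<open>\<theta>\<close> and parameter \<open>F\<close>. Here \<open>F\<close> is a measure on the Borel sets of the reals that is
  concentrated on the half line, whereas the realisations of \<open>P\<close> live on the half line itself.
\<close>
definition dirichlet_process ::
    "'a measure \<Rightarrow> ('a \<Rightarrow> real measure) \<Rightarrow> real \<Rightarrow> real measure \<Rightarrow> bool" where
  "dirichlet_process \<Omega> P \<theta> F \<longleftrightarrow>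
     prob_space \<Omega> \<and>
     P \<in> \<Omega> \<rightarrow>\<^sub>M prob_algebra (restrict_space borel {0..}) \<and>
     (\<forall>k C. (\<forall>i<k. C i \<in> sets borel) \<and> disjoint_family_on C {..<k} \<and>
            (\<Union>i<k. C i) = {0..} \<longrightarrow>
        distr \<Omega> (\<Pi>\<^sub>M i\<in>{..<k}. borel) (\<lambda>\<omega>. \<lambda>i\<in>{..<k}. measure (P \<omega>) (C i))
          = dirichlet_law k (\<lambda>i. \<theta> * measure F (C i)))"

text \<open>
  The Bochner integral is 0 when the integral diverges, so statements about the mean come
  with almost sure integrability.
\<close>
definition dirichlet_mean :: "('a \<Rightarrow> real measure) \<Rightarrow> 'a \<Rightarrow> real" where
  "dirichlet_mean P \<omega> = (\<integral>x. x \<partial>P \<omega>)"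

definition dirichlet_mean_finite :: "'a measure \<Rightarrow> ('a \<Rightarrow> real measure) \<Rightarrow> bool" where
  "dirichlet_mean_finite \<Omega> P \<longleftrightarrow> (AE \<omega> in \<Omega>. integrable (P \<omega>) (\<lambda>x. x))"

definition dirichlet_mean_law :: "'a measure \<Rightarrow> ('a \<Rightarrow> real measure) \<Rightarrow> real measure" where
  "dirichlet_mean_law \<Omega> P = distr \<Omega> borel (dirichlet_mean P)"

text \<open>
  If \<open>P\<close> is a Dirichlet process on \<open>\<Omega>\<close> with total mass \<open>\<theta>\<close> and parameter \<open>F\<close>, this is the law
  GGC(\<open>\<theta>\<close>, \<open>F\<close>).
\<close>
definition GGC_law :: "real \<Rightarrow> 'a measure \<Rightarrow> ('a \<Rightarrow> real measure) \<Rightarrow> real measure" where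
  "GGC_law \<theta> \<Omega> P = mult_law (gamma_law \<theta>) (dirichlet_mean_law \<Omega> P)"

end

theory Submission
  imports Defs
begin

text \<open>
For a nonnegative variable \<open>Y\<close> consider the transform \<open>l \<mapsto> E (1 + l Y)\<^bsup>-a\<^esup>\<close>. Mixing over an
independent gamma variable turns it into the Laplace transform of \<open>G\<^sub>a Y\<close>, and it determines the
law of \<open>Y\<close> (\<open>stieltjes_transform_determines_law\<close>), because it is also, up to a factor and the
change of argument \<open>l \<mapsto> 1 / l\<close>, the Laplace transform of the measure with density
\<open>s\<^bsup>a-1\<^esup> E e\<^bsup>-sY\<^esup>\<close>. All the distributional identities that involve a Dirichlet mean are proved
by comparing such transforms.

For the mean \<open>M\<close> of a Dirichlet process of total mass \<open>m\<close> and parameter \<open>F\<close>, the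
Markov-Krein identity says \<open>E (1 + l M)\<^bsup>-m\<^esup> = exp (- m \<integral> log (1 + l x) F(dx))\<close>
(\<open>dirichlet_mean_stieltjes\<close>). If a simple function takes the place of the identity, then the mean is a
linear form in a Dirichlet vector, that is, in independent gamma variables divided by their sum.
The sum is independent of the ratios (\<open>gamma_sum_independent_of_ratios\<close>), so multiplying by an
independent copy of the sum restores the independent gamma variables, whose Laplace transform is
a product. Simple functions increasing to the identity give the general case. The limit
also covers realisations with infinite mean, which contribute 0; letting \<open>l\<close> tend to 0
then shows that the mean is finite almost surely.

The parameter distributions of the proposition have an explicit exponent, since
\<open>E log (1 + r\<^sup>2 X) = 2 log (1 + r)\<close> for the ratio \<open>X\<close> of two independent half-gamma variables
(\<open>X_half_law_log_moment\<close>), and a Bernoulli factor multiplies this by its success probability. Both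
choices, mass \<open>\<theta> + 1\<close> with success probability \<open>(\<theta> + 1/2) / (\<theta> + 1)\<close> and mass \<open>\<theta> + 1/2\<close> without
a Bernoulli factor, lead to the same function \<open>(1 + r)\<^bsup>-(2\<theta>+1)\<^esup>\<close>. A direct calculation shows that
\<open>G\<^bsub>\<theta>+1/2\<^esub> / G\<^bsub>1/2\<^esub>\<close> has this transform of order \<open>\<theta> + 1\<close> as well
(\<open>gamma_ratio_half_stieltjes\<close>). The two identities without Dirichlet means are beta-gamma algebra:
\<open>\<beta>\<^bsub>a,b\<^esub> G\<^bsub>a+b\<^esub>\<close> has the law of \<open>G\<^sub>a\<close>, and independent factors may be permuted.
\<close>

section \<open>Laplace transforms of measures on the half line\<close>

text \<open>
The values at the natural numbers are the moments of \<open>e\<^bsup>-x\<^esup>\<close>, a variable with values in the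
compact interval from 0 to 1. By the Weierstrass theorem they determine the integrals of all continuous
functions of \<open>e\<^bsup>-x\<^esup>\<close>, and piecewise linear functions of this kind approximate the indicators that
define the distribution function.
\<close>
lemma laplace_transform_determines_measure:
  fixes M N :: "real measure"
  assumes fin: "finite_measure M" "finite_measure N"
    and sets [measurable_cong]: "sets M = sets borel" "sets N = sets borel"
    and nonneg: "AE x in M. 0 \<le> x" "AE x in N. 0 \<le> x"
    and eq: "\<And>n::nat. (\<integral>\<^sup>+x. ennreal (exp (- real n * x)) \<partial>M) = (\<integral>\<^sup>+x. ennreal (exp (- real n * x)) \<partial>N)"
  shows "M = N"
proof -
  have int: "integrable K (\<lambda>x. f (exp (- x)))"
    if K: "finite_measure K" "sets K = sets borel" "AE x in K. 0 \<le> x"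
      and f: "f \<in> borel_measurable borel" "continuous_on {0..1} f" for f :: "real \<Rightarrow> real" and K
  proof -
    interpret finite_measure K by fact
    note [measurable_cong] = K(2)
    note [measurable] = f(1)
    have "bounded (f ` {0..1})"
      using f(2) by (intro compact_imp_bounded compact_continuous_image) auto
    then obtain B where B: "\<forall>u\<in>{0..1}. norm (f u) \<le> B"
      by (auto simp: bounded_iff)
    have "AE x in K. norm (f (exp (- x))) \<le> B"
      using K(3) by eventually_elim (use B in auto)
    then show ?thesis
      by (intro integrable_const_bound[of _ B]) auto
  qed
  have mono: "(\<integral>x. exp (- x) ^ k \<partial>M) = (\<integral>x. exp (- x) ^ k \<partial>N)" for k :: nat
  proof -
    have *: "exp (- x) ^ k = exp (- real k * x)" for x :: real
      by (simp add: exp_of_nat_mult[symmetric])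
    show ?thesis
      unfolding * using eq[of k] by (simp add: integral_eq_nn_integral)
  qed
  have poly: "(\<integral>x. p (exp (- x)) \<partial>M) = (\<integral>x. p (exp (- x)) \<partial>N)"
    if p: "real_polynomial_function p" for p
  proof -
    obtain a n where an: "p = (\<lambda>x. \<Sum>i\<le>n. a i * x ^ i)"
      using p by (auto simp: real_polynomial_function_iff_sum)
    have "integrable M (\<lambda>x. exp (- x) ^ i)" "integrable N (\<lambda>x. exp (- x) ^ i)" for i :: nat
      using int[of M "\<lambda>u. u ^ i"] int[of N "\<lambda>u. u ^ i"] fin sets nonneg
      by (simp_all add: continuous_on_power continuous_on_id)
    then show ?thesis
      by (simp add: an mono)
  qed
  have cont: "(\<integral>x. f (exp (- x)) \<partial>M) = (\<integral>x. f (exp (- x)) \<partial>N)"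
    if f [measurable]: "f \<in> borel_measurable borel" "continuous_on {0..1} f" for f :: "real \<Rightarrow> real"
  proof -
    define C where "C = measure M (space M) + measure N (space N)"
    have le: "\<bar>(\<integral>x. f (exp (- x)) \<partial>M) - (\<integral>x. f (exp (- x)) \<partial>N)\<bar> \<le> e * C" if e: "e > 0" for e
    proof -
      obtain p where p: "real_polynomial_function p" "\<And>u. u \<in> {0..1} \<Longrightarrow> \<bar>f u - p u\<bar> < e"
        using Stone_Weierstrass_real_polynomial_function[of "{0..1}" f e] f(2) e by auto
      have pc: "continuous_on A p" for A
        using p(1) continuous_real_polymonial_function continuous_at_imp_continuous_on by blast
      have [measurable]: "p \<in> borel_measurable borel"
        by (intro borel_measurable_continuous_onI pc)
      have bound: "\<bar>(\<integral>x. f (exp (- x)) \<partial>K) - (\<integral>x. p (exp (- x)) \<partial>K)\<bar> \<le> e * measure K (space K)"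
        if K: "finite_measure K" "sets K = sets borel" "AE x in K. 0 \<le> x" for K
      proof -
        interpret finite_measure K by fact
        note [measurable_cong] = K(2)
        have i: "integrable K (\<lambda>x. f (exp (- x)))" "integrable K (\<lambda>x. p (exp (- x)))"
          using int[OF K, of f] int[OF K, of p] f pc by auto
        then have "\<bar>(\<integral>x. f (exp (- x)) \<partial>K) - (\<integral>x. p (exp (- x)) \<partial>K)\<bar>
            = \<bar>\<integral>x. f (exp (- x)) - p (exp (- x)) \<partial>K\<bar>" by simp
        also have "\<dots> \<le> (\<integral>x. \<bar>f (exp (- x)) - p (exp (- x))\<bar> \<partial>K)"
          by (rule integral_abs_bound)
        also have "\<dots> \<le> (\<integral>x. e \<partial>K)"
        proof (rule integral_mono_AE)
          show "AE x in K. \<bar>f (exp (- x)) - p (exp (- x))\<bar> \<le> e"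
            using K(3) by eventually_elim (auto intro!: less_imp_le p(2))
        qed (use i in auto)
        finally show ?thesis by (simp add: mult.commute)
      qed
      show ?thesis
        using bound[OF fin(1) sets(1) nonneg(1)] bound[OF fin(2) sets(2) nonneg(2)] poly[OF p(1)]
        unfolding C_def distrib_left by (simp add: abs_le_iff)
    qed
    have "C \<ge> 0" by (simp add: C_def)
    have "\<bar>(\<integral>x. f (exp (- x)) \<partial>M) - (\<integral>x. f (exp (- x)) \<partial>N)\<bar> \<le> 0 + e" if "e > 0" for e
    proof -
      have "e / (C + 1) * C \<le> e" using \<open>C \<ge> 0\<close> that by (simp add: field_simps)
      then show ?thesis using le[of "e / (C + 1)"] that \<open>C \<ge> 0\<close> by simp
    qed
    then have "\<bar>(\<integral>x. f (exp (- x)) \<partial>M) - (\<integral>x. f (exp (- x)) \<partial>N)\<bar> \<le> 0"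
      by (rule field_le_epsilon)
    then show ?thesis by simp
  qed
  have "cdf M c = cdf N c" for c
  proof -
    \<comment> \<open>The condition \<open>x \<le> c\<close> reads \<open>u \<ge> exp (- c)\<close> for \<open>u = exp (- x)\<close>.\<close>
    define f where "f n u = min 1 (max 0 (1 + real n * (u - exp (- c))))" for n u
    have fm [measurable]: "f n \<in> borel_measurable borel" for n
      unfolding f_def by measurable
    have fc: "continuous_on {0..1} (f n)" for n
      unfolding f_def by (intro continuous_intros)
    have lim: "(\<lambda>n. f n (exp (- x))) \<longlonglongrightarrow> indicator {..c} x" for x
    proof (cases "x \<le> c")
      case True
      then have "f n (exp (- x)) = 1" for n by (simp add: f_def)
      with True show ?thesis by simp
    next
      case False
      define d where "d = exp (- c) - exp (- x)"
      have d: "d > 0" using False by (simp add: d_def)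
      have "eventually (\<lambda>n. real n > 1 / d) sequentially"
        using filterlim_at_top_dense filterlim_real_sequentially by blast
      then have "eventually (\<lambda>n. f n (exp (- x)) = 0) sequentially"
      proof eventually_elim
        case (elim n)
        then have "real n * d > 1" using d by (simp add: field_simps)
        then show ?case unfolding f_def d_def by (simp add: algebra_simps)
      qed
      then show ?thesis using False by (simp add: tendsto_eventually)
    qed
    have conv: "(\<lambda>n. \<integral>x. f n (exp (- x)) \<partial>K) \<longlonglongrightarrow> cdf K c"
      if K: "finite_measure K" "sets K = sets borel" for K
    proof -
      interpret finite_measure K by fact
      note [measurable_cong] = K(2)
      have sp: "space K = UNIV" using sets_eq_imp_space_eq[OF K(2)] by simp
      have "(\<lambda>n. \<integral>x. f n (exp (- x)) \<partial>K) \<longlonglongrightarrow> (\<integral>x. indicator {..c} x \<partial>K)"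
        by (rule integral_dominated_convergence[where w = "\<lambda>_. 1"])
           (use lim in \<open>auto simp: f_def\<close>)
      then show ?thesis by (simp add: cdf_def sp)
    qed
    have "(\<lambda>n. \<integral>x. f n (exp (- x)) \<partial>M) \<longlonglongrightarrow> cdf N c"
      using conv[OF fin(2) sets(2)] cont[OF fm fc] by simp
    with conv[OF fin(1) sets(1)] show ?thesis by (rule LIMSEQ_unique)
  qed
  then have c: "cdf M = cdf N" by auto
  have fb: "finite_borel_measure K" if "finite_measure K" "sets K = sets borel" for K :: "real measure"
    using that by (simp add: finite_borel_measure_def finite_borel_measure_axioms_def)
  show ?thesis
    by (rule cdf_unique'[OF fb[OF fin(1) sets(1)] fb[OF fin(2) sets(2)] c])
qed

section \<open>Gamma laws under exponential tilting\<close>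

lemma nn_integral_Gamma_scaled:
  assumes "a > 0" "c > 0"
  shows "(\<integral>\<^sup>+x. ennreal (if 0 < x then x powr (a - 1) * exp (- (c * x)) else 0) \<partial>lborel)
    = ennreal (Gamma a / c powr a)"
proof -
  have "(\<integral>\<^sup>+x. ennreal (if 0 < x then x powr (a - 1) * exp (- (c * x)) else 0) \<partial>lborel)
    = ennreal \<bar>1 / c\<bar> * (\<integral>\<^sup>+x. ennreal (if 0 < 0 + 1 / c * x
        then (0 + 1 / c * x) powr (a - 1) * exp (- (c * (0 + 1 / c * x))) else 0) \<partial>lborel)"
    by (rule nn_integral_real_affine) (use assms in auto)
  also have "(\<integral>\<^sup>+x. ennreal (if 0 < 0 + 1 / c * x
        then (0 + 1 / c * x) powr (a - 1) * exp (- (c * (0 + 1 / c * x))) else 0) \<partial>lborel)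
    = (\<integral>\<^sup>+x. ennreal (c powr (1 - a)) * ennreal (indicator {0..} x * x powr (a - 1) / exp x) \<partial>lborel)"
  proof (intro nn_integral_cong_AE, rule AE_I[of _ _ "{0}"], safe)
    fix x :: real
    assume *: "\<not> ennreal (if 0 < 0 + 1 / c * x
        then (0 + 1 / c * x) powr (a - 1) * exp (- (c * (0 + 1 / c * x))) else 0)
      = ennreal (c powr (1 - a)) * ennreal (indicator {0..} x * x powr (a - 1) / exp x)"
    show "x = 0"
    proof (rule ccontr)
      assume "x \<noteq> 0"
      then consider "x > 0" | "x < 0" by linarith
      then show False
      proof cases
        case 1
        have "(x / c) powr (a - 1) = c powr (1 - a) * x powr (a - 1)"
          using 1 assms by (simp add: powr_divide powr_diff field_simps)
        with 1 * assms show False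
          by (simp add: ennreal_mult'[symmetric] exp_minus field_simps)
      next
        case 2
        with * assms show False by (simp add: zero_less_divide_iff)
      qed
    qed
  qed auto
  also have "\<dots> = ennreal (c powr (1 - a)) * ennreal (Gamma a)"
    using assms by (subst nn_integral_cmult) (simp_all add: Gamma_conv_nn_integral_real)
  also have "ennreal \<bar>1 / c\<bar> * \<dots> = ennreal (Gamma a / c powr a)"
    using assms by (simp add: ennreal_mult'[symmetric] powr_diff field_simps)
  finally show ?thesis .
qed

lemma sets_gamma_law [simp, measurable_cong]: "sets (gamma_law a) = sets borel"
  by (simp add: gamma_law_def)

lemma space_gamma_law [simp]: "space (gamma_law a) = UNIV"
  by (simp add: gamma_law_def)

lemma nn_integral_gamma_law:
  assumes "a > 0" and [measurable]: "f \<in> borel_measurable borel"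
  shows "(\<integral>\<^sup>+x. f x \<partial>gamma_law a)
    = (\<integral>\<^sup>+x. ennreal (if 0 < x then x powr (a - 1) * exp (- x) / Gamma a else 0) * f x \<partial>lborel)"
  using assms(1) by (simp add: gamma_law_def nn_integral_density)

lemma gamma_law_nonpos: "a \<le> 0 \<Longrightarrow> gamma_law a = return borel 0"
  by (simp add: gamma_law_def)

lemma prob_space_gamma_law [simp]: "prob_space (gamma_law a)"
proof (cases "a > 0")
  case True
  have "(\<integral>\<^sup>+x. 1 \<partial>gamma_law a)
    = (\<integral>\<^sup>+x. ennreal (1 / Gamma a) * ennreal (if 0 < x then x powr (a - 1) * exp (- (1 * x)) else 0) \<partial>lborel)"
    using True by (subst nn_integral_gamma_law)
      (auto intro!: nn_integral_cong simp: ennreal_mult'[symmetric] Gamma_real_pos)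
  also have "\<dots> = ennreal (1 / Gamma a) * ennreal (Gamma a)"
    using True by (subst nn_integral_cmult) (simp_all add: nn_integral_Gamma_scaled del: mult_1)
  also have "\<dots> = 1"
    using Gamma_real_pos[OF True] by (simp add: ennreal_mult'[symmetric])
  finally show ?thesis by (intro prob_spaceI) simp
qed (simp add: gamma_law_nonpos prob_space_return)

lemma AE_gamma_law_nonneg: "AE x in gamma_law a. 0 \<le> x"
proof (cases "a > 0")
  case True
  then show ?thesis unfolding gamma_law_def by (simp add: AE_density)
next
  case False
  then show ?thesis unfolding gamma_law_def by (simp add: AE_return)
qed

text \<open>
Multiplying the gamma density by \<open>e\<^bsup>-(c-1)x\<^esup>\<close> gives, up to a constant, the density of a rescaled gamma
variable of the same shape. For \<open>a = 0\<close> both sides are \<open>f 0\<close>, so point masses at 0 fit in, as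
the zero parameters of Dirichlet vectors require.
\<close>
lemma gamma_law_tilt:
  assumes "a \<ge> 0" "c > 0" and [measurable]: "f \<in> borel_measurable borel"
  shows "(\<integral>\<^sup>+x. ennreal (exp (- ((c - 1) * x))) * f x \<partial>gamma_law a)
    = ennreal (c powr (- a)) * (\<integral>\<^sup>+x. f (x / c) \<partial>gamma_law a)"
proof (cases "a > 0")
  case True
  let ?d = "\<lambda>x. if 0 < x then x powr (a - 1) * exp (- x) / Gamma a else 0"
  have G: "Gamma a > 0" by (rule Gamma_real_pos[OF True])
  have *: "ennreal (1 / c) * (ennreal (?d (x / c)) * (ennreal (exp (- ((c - 1) * (x / c)))) * f (x / c)))
    = ennreal (c powr (- a)) * (ennreal (?d x) * f (x / c))" for x
  proof (cases "x > 0")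
    case pos: True
    have "exp (- (x / c)) * exp (- ((c - 1) * (x / c))) = exp (- x)"
      using assms(2) by (simp add: exp_add[symmetric] field_simps)
    moreover have "(x / c) powr (a - 1) = c powr (1 - a) * x powr (a - 1)"
      using pos assms by (simp add: powr_divide powr_diff field_simps)
    moreover have "?d (x / c) * exp (- ((c - 1) * (x / c)))
        = (x / c) powr (a - 1) * (exp (- (x / c)) * exp (- ((c - 1) * (x / c)))) / Gamma a"
      using pos assms by simp
    ultimately have d: "?d (x / c) * exp (- ((c - 1) * (x / c))) = c powr (1 - a) * ?d x"
      using pos by simp
    have c: "1 / c * c powr (1 - a) = c powr (- a)"
      using assms by (simp add: powr_diff powr_minus field_simps)
    have "1 / c * (?d (x / c) * exp (- ((c - 1) * (x / c)))) = c powr (- a) * ?d x"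
      by (simp only: d c mult.assoc[symmetric])
    moreover have "?d (x / c) \<ge> 0" "?d x \<ge> 0" using G by auto
    ultimately show ?thesis
      using assms(2) by (simp only: mult.assoc[symmetric] ennreal_mult[symmetric]
        exp_ge_zero mult_nonneg_nonneg powr_ge_zero divide_nonneg_pos zero_le_one)
  next
    case False
    then show ?thesis using assms(2) by (simp add: zero_less_divide_iff)
  qed
  have "(\<integral>\<^sup>+x. ennreal (exp (- ((c - 1) * x))) * f x \<partial>gamma_law a)
     = (\<integral>\<^sup>+x. ennreal (?d x) * (ennreal (exp (- ((c - 1) * x))) * f x) \<partial>lborel)"
    by (rule nn_integral_gamma_law[OF True]) simp
  also have "\<dots> = ennreal \<bar>1 / c\<bar> * (\<integral>\<^sup>+x. ennreal (?d (0 + 1 / c * x)) *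
      (ennreal (exp (- ((c - 1) * (0 + 1 / c * x)))) * f (0 + 1 / c * x)) \<partial>lborel)"
    using assms(2) by (intro nn_integral_real_affine) simp_all
  also have "\<dots> = ennreal (1 / c) * (\<integral>\<^sup>+x. ennreal (?d (x / c)) *
      (ennreal (exp (- ((c - 1) * (x / c)))) * f (x / c)) \<partial>lborel)"
  proof -
    have "0 + 1 / c * x = x / c" "\<bar>1 / c\<bar> = 1 / c" for x using assms(2) by auto
    then show ?thesis by (simp only:)
  qed
  also have "\<dots> = (\<integral>\<^sup>+x. ennreal (1 / c) * (ennreal (?d (x / c)) *
      (ennreal (exp (- ((c - 1) * (x / c)))) * f (x / c))) \<partial>lborel)"
    by (rule nn_integral_cmult[symmetric]) measurable
  also have "\<dots> = (\<integral>\<^sup>+x. ennreal (c powr (- a)) * (ennreal (?d x) * f (x / c)) \<partial>lborel)"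
    by (simp only: *)
  also have "\<dots> = ennreal (c powr (- a)) * (\<integral>\<^sup>+x. f (x / c) \<partial>gamma_law a)"
    by (subst nn_integral_cmult) (simp_all add: nn_integral_gamma_law[OF True])
  finally show ?thesis .
next
  case False
  then show ?thesis using assms by (simp add: gamma_law_nonpos nn_integral_return)
qed

lemma gamma_law_laplace:
  assumes "a \<ge> 0" "t \<ge> 0"
  shows "(\<integral>\<^sup>+x. ennreal (exp (- (t * x))) \<partial>gamma_law a) = ennreal ((1 + t) powr (- a))"
  using gamma_law_tilt[of a "1 + t" "\<lambda>_. 1"] assms prob_space.emeasure_space_1[OF prob_space_gamma_law, of a]
  by simp

lemma sets_PiM_gamma_law:
  "sets (\<Pi>\<^sub>M i\<in>I. gamma_law (\<alpha> i)) = sets (\<Pi>\<^sub>M i\<in>I. borel)"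
  by (intro sets_PiM_cong) auto

text \<open>
Tilting all coordinates by the same factor amounts to tilting by a function of the sum. The
effect is a simultaneous rescaling, which leaves functions of the ratios unchanged; this is what makes the
sum independent of the ratios.
\<close>
lemma gamma_product_tilt:
  assumes "finite I" "\<And>i. i \<in> I \<Longrightarrow> \<alpha> i \<ge> 0" "c > 0" "f \<in> borel_measurable (\<Pi>\<^sub>M i\<in>I. borel)"
  shows "(\<integral>\<^sup>+g. (\<Prod>i\<in>I. ennreal (exp (- ((c - 1) * g i)))) * f g \<partial>(\<Pi>\<^sub>M i\<in>I. gamma_law (\<alpha> i)))
    = ennreal (c powr (- sum \<alpha> I)) * (\<integral>\<^sup>+g. f (\<lambda>i\<in>I. g i / c) \<partial>(\<Pi>\<^sub>M i\<in>I. gamma_law (\<alpha> i)))"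
  using assms(1,2,4)
proof (induction I arbitrary: f rule: finite_induct)
  case empty
  then show ?case using assms(3) by (simp add: PiM_empty nn_integral_count_space_finite restrict_def)
next
  case (insert i I)
  interpret product_sigma_finite "\<lambda>i. gamma_law (\<alpha> i)"
    by (simp add: product_sigma_finite_def prob_space_imp_sigma_finite)
  note [measurable] = insert.prems(2)
  note [measurable_cong] = sets_PiM_gamma_law
  let ?e = "\<lambda>y. ennreal (exp (- ((c - 1) * y)))"
  let ?P = "\<Pi>\<^sub>M i\<in>I. gamma_law (\<alpha> i)"
  let ?F = "\<lambda>x. ennreal (c powr (- \<alpha> i)) * (\<integral>\<^sup>+y. f (x(i := y / c)) \<partial>gamma_law (\<alpha> i))"
  have [measurable]: "(\<lambda>(x, y). f (x(i := y / c))) \<in> borel_measurable ((\<Pi>\<^sub>M i\<in>I. borel) \<Otimes>\<^sub>M borel)"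
    by measurable
  have s: "sigma_finite_measure (gamma_law (\<alpha> i))"
    by (simp add: prob_space_imp_sigma_finite)
  have F [measurable]: "?F \<in> borel_measurable (\<Pi>\<^sub>M i\<in>I. borel)"
    by (intro borel_measurable_times_ennreal borel_measurable_const
          sigma_finite_measure.borel_measurable_nn_integral[OF s]) measurable
  have "(\<integral>\<^sup>+g. (\<Prod>j\<in>insert i I. ?e (g j)) * f g \<partial>(\<Pi>\<^sub>M i\<in>insert i I. gamma_law (\<alpha> i)))
    = (\<integral>\<^sup>+x. \<integral>\<^sup>+y. (\<Prod>j\<in>insert i I. ?e ((x(i := y)) j)) * f (x(i := y)) \<partial>gamma_law (\<alpha> i) \<partial>?P)"
    by (rule product_nn_integral_insert) (use insert in measurable)
  also have "\<dots> = (\<integral>\<^sup>+x. (\<Prod>j\<in>I. ?e (x j)) * ?F x \<partial>?P)"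
  proof (rule nn_integral_cong)
    fix x assume "x \<in> space ?P"
    then have [measurable]: "x \<in> space (\<Pi>\<^sub>M i\<in>I. borel)"
      by (simp add: space_PiM)
    have [measurable]: "(\<lambda>y. f (x(i := y))) \<in> borel_measurable borel"
      by measurable
    have *: "(\<Prod>j\<in>insert i I. ?e ((x(i := y)) j)) = (\<Prod>j\<in>I. ?e (x j)) * ?e y" for y
    proof -
      have "(\<Prod>j\<in>I. ?e ((x(i := y)) j)) = (\<Prod>j\<in>I. ?e (x j))"
        using insert(2) by (intro prod.cong) auto
      then show ?thesis using insert(1,2) by (simp add: mult.commute)
    qed
    have "(\<integral>\<^sup>+y. (\<Prod>j\<in>insert i I. ?e ((x(i := y)) j)) * f (x(i := y)) \<partial>gamma_law (\<alpha> i))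
      = (\<Prod>j\<in>I. ?e (x j)) * (\<integral>\<^sup>+y. ?e y * f (x(i := y)) \<partial>gamma_law (\<alpha> i))"
      unfolding * mult.assoc by (rule nn_integral_cmult) measurable
    also have "(\<integral>\<^sup>+y. ?e y * f (x(i := y)) \<partial>gamma_law (\<alpha> i)) = ?F x"
      using insert.prems(1) by (intro gamma_law_tilt assms(3)) auto
    finally show "(\<integral>\<^sup>+y. (\<Prod>j\<in>insert i I. ?e ((x(i := y)) j)) * f (x(i := y)) \<partial>gamma_law (\<alpha> i))
      = (\<Prod>j\<in>I. ?e (x j)) * ?F x" .
  qed
  also have "\<dots> = ennreal (c powr (- sum \<alpha> I)) * (\<integral>\<^sup>+x. ?F (\<lambda>i\<in>I. x i / c) \<partial>?P)"
    by (rule insert.IH[OF _ F]) (simp add: insert.prems(1))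
  also have "(\<integral>\<^sup>+x. ?F (\<lambda>i\<in>I. x i / c) \<partial>?P)
    = ennreal (c powr (- \<alpha> i)) * (\<integral>\<^sup>+x. \<integral>\<^sup>+y. f ((\<lambda>i\<in>I. x i / c)(i := y / c)) \<partial>gamma_law (\<alpha> i) \<partial>?P)"
    by (rule nn_integral_cmult, rule sigma_finite_measure.borel_measurable_nn_integral[OF s]) measurable
  also have "(\<integral>\<^sup>+x. \<integral>\<^sup>+y. f ((\<lambda>i\<in>I. x i / c)(i := y / c)) \<partial>gamma_law (\<alpha> i) \<partial>?P)
    = (\<integral>\<^sup>+x. \<integral>\<^sup>+y. f (\<lambda>j\<in>insert i I. (x(i := y)) j / c) \<partial>gamma_law (\<alpha> i) \<partial>?P)"
    using insert(2) by (intro nn_integral_cong arg_cong[where f = f]) (auto simp: restrict_def fun_eq_iff)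
  also have "\<dots> = (\<integral>\<^sup>+g. f (\<lambda>j\<in>insert i I. g j / c) \<partial>(\<Pi>\<^sub>M i\<in>insert i I. gamma_law (\<alpha> i)))"
    by (rule product_nn_integral_insert[symmetric]) (use insert in measurable)
  also have "ennreal (c powr (- sum \<alpha> I)) * (ennreal (c powr (- \<alpha> i)) * K)
    = ennreal (c powr (- sum \<alpha> (insert i I))) * K" for K
    using insert(1,2) assms(3)
    by (simp add: mult.assoc[symmetric] ennreal_mult'[symmetric] powr_add[symmetric] add.commute)
  finally show ?case .
qed

section \<open>Dirichlet vectors\<close>

lemma AE_PiM_gamma_law_nonneg:
  assumes "finite I"
  shows "AE g in (\<Pi>\<^sub>M i\<in>I. gamma_law (\<alpha> i)). \<forall>i\<in>I. 0 \<le> g i"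
  using assms by (intro eventually_ball_finite ballI AE_PiM_component AE_gamma_law_nonneg) auto

text \<open>
For a scale-invariant \<open>H\<close>, tilting shows that the event \<open>H g \<in> B\<close> affects the Laplace
transform of the sum only through the factor \<open>P(H g \<in> B)\<close>. Hence on that event the sum has the
gamma law multiplied by this factor.
\<close>
lemma gamma_sum_independent_of_ratios:
  assumes I: "finite I" and \<alpha>: "\<And>i. i \<in> I \<Longrightarrow> \<alpha> i \<ge> 0"
    and H [measurable]: "H \<in> borel_measurable (\<Pi>\<^sub>M i\<in>I. borel)"
    and scale: "\<And>c g. c > 0 \<Longrightarrow> H (\<lambda>i\<in>I. g i / c) = H g"
  defines "\<Gamma> \<equiv> \<Pi>\<^sub>M i\<in>I. gamma_law (\<alpha> i)"
  shows "gamma_law (sum \<alpha> I) \<Otimes>\<^sub>M distr \<Gamma> borel H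
    = distr \<Gamma> (borel \<Otimes>\<^sub>M borel) (\<lambda>g. (\<Sum>i\<in>I. g i, H g :: real))"
proof (rule pair_measure_eqI)
  have \<Gamma>_sets [measurable_cong]: "sets \<Gamma> = sets (\<Pi>\<^sub>M i\<in>I. borel)"
    unfolding \<Gamma>_def by (rule sets_PiM_gamma_law)
  interpret \<Gamma>: prob_space \<Gamma>
    unfolding \<Gamma>_def by (intro prob_space_PiM prob_space_gamma_law)
  interpret D: prob_space "distr \<Gamma> borel H"
    by (rule \<Gamma>.prob_space_distr) measurable
  have sum_nn: "sum \<alpha> I \<ge> 0" using \<alpha> by (rule sum_nonneg)
  show "sigma_finite_measure (gamma_law (sum \<alpha> I))"
    by (simp add: prob_space_imp_sigma_finite)
  show "sigma_finite_measure (distr \<Gamma> borel H)"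
    by (rule D.sigma_finite_measure_axioms)
  show "sets (gamma_law (sum \<alpha> I) \<Otimes>\<^sub>M distr \<Gamma> borel H)
    = sets (distr \<Gamma> (borel \<Otimes>\<^sub>M borel) (\<lambda>g. (\<Sum>i\<in>I. g i, H g)))"
    by (simp cong: sets_pair_measure_cong)
  fix A B :: "real set"
  assume "A \<in> sets (gamma_law (sum \<alpha> I))" and "B \<in> sets (distr \<Gamma> borel H)"
  then have [measurable]: "A \<in> sets borel" "B \<in> sets borel" by auto
  define w where "w = emeasure \<Gamma> {g \<in> space \<Gamma>. H g \<in> B}"
  have w: "w \<le> 1" unfolding w_def by (rule \<Gamma>.measure_le_1)
  have w_int: "(\<integral>\<^sup>+g. indicator B (H g) \<partial>\<Gamma>) = w"
  proof -
    have "(\<integral>\<^sup>+g. indicator B (H g) \<partial>\<Gamma>) = (\<integral>\<^sup>+g. indicator {g \<in> space \<Gamma>. H g \<in> B} g \<partial>\<Gamma>)"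
      by (intro nn_integral_cong) (auto simp: indicator_def)
    then show ?thesis by (simp add: w_def)
  qed
  let ?S = "\<lambda>g :: 'a \<Rightarrow> real. \<Sum>i\<in>I. g i"
  \<comment> \<open>The law of the sum on the event \<open>H g \<in> B\<close>, and the multiple of the gamma law that independence predicts for it.\<close>
  define M1 where "M1 = distr (density \<Gamma> (\<lambda>g. indicator B (H g))) borel ?S"
  define M2 where "M2 = density (gamma_law (sum \<alpha> I)) (\<lambda>_. w)"
  have [measurable_cong]: "sets M1 = sets borel" "sets M2 = sets borel"
    by (simp_all add: M1_def M2_def)
  have M1_int: "(\<integral>\<^sup>+x. f x \<partial>M1) = (\<integral>\<^sup>+g. indicator B (H g) * f (?S g) \<partial>\<Gamma>)"
    if [measurable]: "f \<in> borel_measurable borel" for f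
    by (simp add: M1_def nn_integral_distr nn_integral_density)
  have M2_int: "(\<integral>\<^sup>+x. f x \<partial>M2) = w * (\<integral>\<^sup>+x. f x \<partial>gamma_law (sum \<alpha> I))"
    if [measurable]: "f \<in> borel_measurable borel" for f
    by (simp add: M2_def nn_integral_density nn_integral_cmult)
  have "M1 = M2"
  proof (rule laplace_transform_determines_measure)
    have "emeasure M1 (space M1) = w"
      using M1_int[of "\<lambda>_. 1"] w_int by simp
    then show "finite_measure M1"
      using w by (intro finite_measureI) (auto simp: top_unique)
    have "emeasure M2 (space M2) = w"
      using M2_int[of "\<lambda>_. 1"] prob_space.emeasure_space_1[OF prob_space_gamma_law, of "sum \<alpha> I"]
      by simp
    then show "finite_measure M2"
      using w by (intro finite_measureI) (auto simp: top_unique)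
    show "AE x in M2. 0 \<le> x"
      unfolding M2_def using AE_gamma_law_nonneg[of "sum \<alpha> I"] by (auto simp: AE_density)
    have "AE g in \<Gamma>. 0 \<le> ?S g"
      using AE_PiM_gamma_law_nonneg[OF I, of \<alpha>] unfolding \<Gamma>_def
      by eventually_elim (auto intro: sum_nonneg)
    then show "AE x in M1. 0 \<le> x"
      unfolding M1_def by (auto simp: AE_density AE_distr_iff)
    fix n :: nat
    have "(\<integral>\<^sup>+x. ennreal (exp (- real n * x)) \<partial>M1)
      = (\<integral>\<^sup>+g. (\<Prod>i\<in>I. ennreal (exp (- ((1 + real n - 1) * g i)))) * indicator B (H g) \<partial>\<Gamma>)"
      using I by (subst M1_int)
        (auto intro!: nn_integral_cong
          simp: prod_ennreal exp_sum[symmetric] sum_distrib_left sum_negf[symmetric] mult.commute)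
    also have "\<dots> = ennreal ((1 + real n) powr (- sum \<alpha> I)) * (\<integral>\<^sup>+g. indicator B (H (\<lambda>i\<in>I. g i / (1 + real n))) \<partial>\<Gamma>)"
      unfolding \<Gamma>_def by (rule gamma_product_tilt) (use I \<alpha> in auto)
    also have "\<dots> = ennreal ((1 + real n) powr (- sum \<alpha> I)) * w"
      by (simp add: scale w_int)
    also have "\<dots> = w * (\<integral>\<^sup>+x. ennreal (exp (- (real n * x))) \<partial>gamma_law (sum \<alpha> I))"
      using sum_nn by (subst gamma_law_laplace) (simp_all add: mult.commute[of w])
    also have "\<dots> = (\<integral>\<^sup>+x. ennreal (exp (- real n * x)) \<partial>M2)"
      by (simp add: M2_int)
    finally show "(\<integral>\<^sup>+x. ennreal (exp (- real n * x)) \<partial>M1) = (\<integral>\<^sup>+x. ennreal (exp (- real n * x)) \<partial>M2)" .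
  qed (simp_all add: M1_def M2_def)
  then have "(\<integral>\<^sup>+x. indicator A x \<partial>M1) = (\<integral>\<^sup>+x. indicator A x \<partial>M2)" by simp
  then have *: "(\<integral>\<^sup>+g. indicator B (H g) * indicator A (?S g) \<partial>\<Gamma>) = w * emeasure (gamma_law (sum \<alpha> I)) A"
    by (subst (asm) M1_int, simp, subst (asm) M2_int) simp_all
  have "emeasure (distr \<Gamma> (borel \<Otimes>\<^sub>M borel) (\<lambda>g. (?S g, H g))) (A \<times> B)
    = (\<integral>\<^sup>+x. indicator (A \<times> B) x \<partial>distr \<Gamma> (borel \<Otimes>\<^sub>M borel) (\<lambda>g. (?S g, H g)))"
    by simp
  also have "\<dots> = (\<integral>\<^sup>+g. indicator (A \<times> B) (?S g, H g) \<partial>\<Gamma>)"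
    by (rule nn_integral_distr) measurable
  also have "\<dots> = (\<integral>\<^sup>+g. indicator B (H g) * indicator A (?S g) \<partial>\<Gamma>)"
    by (intro nn_integral_cong) (auto simp: indicator_def)
  also have "\<dots> = emeasure (gamma_law (sum \<alpha> I)) A * w"
    by (simp add: * mult.commute)
  also have "w = (\<integral>\<^sup>+x. indicator B x \<partial>distr \<Gamma> borel H)"
    by (subst nn_integral_distr) (simp_all add: w_int)
  finally show "emeasure (gamma_law (sum \<alpha> I)) A * emeasure (distr \<Gamma> borel H) B
    = emeasure (distr \<Gamma> (borel \<Otimes>\<^sub>M borel) (\<lambda>g. (?S g, H g))) (A \<times> B)"
    by simp
qed

text \<open>
The left-hand side is the Laplace transform at 1 of \<open>S H\<close>, where \<open>H\<close> is the linear form in the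
Dirichlet vector and \<open>S\<close> an independent gamma variable. By independence \<open>S\<close> may be taken to be the
sum that normalises the vector, and then \<open>S H\<close> is a linear form in independent gamma variables.
\<close>
lemma dirichlet_law_stieltjes:
  assumes \<alpha>: "\<And>i. i < k \<Longrightarrow> \<alpha> i \<ge> 0" and c: "\<And>i. i < k \<Longrightarrow> c i \<ge> 0"
  shows "(\<integral>\<^sup>+p. ennreal ((1 + (\<Sum>i<k. c i * p i)) powr (- (\<Sum>i<k. \<alpha> i))) \<partial>dirichlet_law k \<alpha>)
    = ennreal (\<Prod>i<k. (1 + c i) powr (- \<alpha> i))"
proof -
  let ?I = "{..<k}"
  define \<Gamma> where "\<Gamma> = (\<Pi>\<^sub>M i\<in>?I. gamma_law (\<alpha> i))"
  have [measurable_cong]: "sets \<Gamma> = sets (\<Pi>\<^sub>M i\<in>?I. borel)"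
    unfolding \<Gamma>_def by (rule sets_PiM_gamma_law)
  interpret \<Gamma>: prob_space \<Gamma>
    unfolding \<Gamma>_def by (intro prob_space_PiM prob_space_gamma_law)
  interpret product_sigma_finite "\<lambda>i. gamma_law (\<alpha> i)"
    by (simp add: product_sigma_finite_def prob_space_imp_sigma_finite)
  define H where "H g = (\<Sum>i<k. c i * (g i / (\<Sum>j<k. g j)))" for g :: "nat \<Rightarrow> real"
  have [measurable]: "H \<in> borel_measurable (\<Pi>\<^sub>M i\<in>?I. borel)"
    unfolding H_def by measurable
  interpret D: prob_space "distr \<Gamma> borel H"
    by (rule \<Gamma>.prob_space_distr) measurable
  interpret G: prob_space "gamma_law (sum \<alpha> ?I)" by simp
  interpret GD: pair_sigma_finite "gamma_law (sum \<alpha> ?I)" "distr \<Gamma> borel H" ..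
  have indep: "gamma_law (sum \<alpha> ?I) \<Otimes>\<^sub>M distr \<Gamma> borel H
    = distr \<Gamma> (borel \<Otimes>\<^sub>M borel) (\<lambda>g. (\<Sum>i<k. g i, H g))"
    unfolding \<Gamma>_def
  proof (rule gamma_sum_independent_of_ratios)
    fix b :: real and g :: "nat \<Rightarrow> real" assume "b > 0"
    then show "H (\<lambda>i\<in>?I. g i / b) = H g"
      unfolding H_def by (intro sum.cong refl) (simp add: sum_divide_distrib[symmetric])
  qed (use \<alpha> in auto)
  have nonneg: "AE g in \<Gamma>. \<forall>i\<in>?I. 0 \<le> g i"
    unfolding \<Gamma>_def by (rule AE_PiM_gamma_law_nonneg) simp
  have H_nonneg: "AE g in \<Gamma>. 0 \<le> H g"
    using nonneg by eventually_elim (auto simp: H_def intro!: sum_nonneg mult_nonneg_nonneg divide_nonneg_nonneg c)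
  have "(\<integral>\<^sup>+p. ennreal ((1 + (\<Sum>i<k. c i * p i)) powr (- (\<Sum>i<k. \<alpha> i))) \<partial>dirichlet_law k \<alpha>)
    = (\<integral>\<^sup>+g. ennreal ((1 + H g) powr (- sum \<alpha> ?I)) \<partial>\<Gamma>)"
    unfolding dirichlet_law_def \<Gamma>_def[symmetric] H_def
    by (subst nn_integral_distr) (auto intro!: nn_integral_cong)
  also have "\<dots> = (\<integral>\<^sup>+g. \<integral>\<^sup>+s. ennreal (exp (- (H g * s))) \<partial>gamma_law (sum \<alpha> ?I) \<partial>\<Gamma>)"
  proof (rule nn_integral_cong_AE, use H_nonneg in eventually_elim)
    case (elim g)
    then show ?case
      using \<alpha> by (intro gamma_law_laplace[symmetric] sum_nonneg) auto
  qed
  also have "\<dots> = (\<integral>\<^sup>+h. \<integral>\<^sup>+s. ennreal (exp (- (h * s))) \<partial>gamma_law (sum \<alpha> ?I) \<partial>distr \<Gamma> borel H)"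
    by (subst nn_integral_distr) (simp_all add: G.borel_measurable_nn_integral)
  also have "\<dots> = (\<integral>\<^sup>+z. ennreal (exp (- (snd z * fst z))) \<partial>(gamma_law (sum \<alpha> ?I) \<Otimes>\<^sub>M distr \<Gamma> borel H))"
    by (subst GD.nn_integral_snd[symmetric]) simp_all
  also have "\<dots> = (\<integral>\<^sup>+g. ennreal (exp (- (H g * (\<Sum>i<k. g i)))) \<partial>\<Gamma>)"
    unfolding indep by (subst nn_integral_distr) simp_all
  also have "\<dots> = (\<integral>\<^sup>+g. (\<Prod>i<k. ennreal (exp (- (c i * g i)))) \<partial>\<Gamma>)"
  proof (rule nn_integral_cong_AE, use nonneg in eventually_elim)
    case (elim g)
    have "H g * (\<Sum>i<k. g i) = (\<Sum>i<k. c i * g i)"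
    \<comment> \<open>If the sum is 0, then so are all its nonnegative terms, and the value 0 of \<open>x / 0\<close> does no harm.\<close>
    proof (cases "(\<Sum>i<k. g i) = 0")
      case True
      then have "\<forall>i<k. g i = 0"
        using elim by (subst (asm) sum_nonneg_eq_0_iff) auto
      then show ?thesis by simp
    next
      case False
      then show ?thesis unfolding H_def sum_distrib_right by (intro sum.cong) auto
    qed
    then show ?case
      by (simp add: prod_ennreal exp_sum[symmetric] sum_negf[symmetric])
  qed
  also have "\<dots> = (\<Prod>i<k. \<integral>\<^sup>+x. ennreal (exp (- (c i * x))) \<partial>gamma_law (\<alpha> i))"
    unfolding \<Gamma>_def by (rule product_nn_integral_prod) simp_all
  also have "\<dots> = (\<Prod>i<k. ennreal ((1 + c i) powr (- \<alpha> i)))"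
    by (intro prod.cong refl gamma_law_laplace) (use \<alpha> c in auto)
  also have "\<dots> = ennreal (\<Prod>i<k. (1 + c i) powr (- \<alpha> i))"
    by (rule prod_ennreal) simp
  finally show ?thesis .
qed

section \<open>Changes of variables on the line\<close>

text \<open>
The image of the measure \<open>g'(x) dx\<close> under \<open>g\<close> gives every interval its length, by the fundamental
theorem of calculus, and so is Lebesgue measure.
\<close>
lemma nn_integral_substitution_onto_reals:
  fixes g g' :: "real \<Rightarrow> real" and D :: "real set"
  assumes D: "is_interval D" "D \<in> sets borel" and onto: "g ` D = UNIV"
    and mono: "strict_mono_on D g"
    and deriv: "\<And>x. x \<in> D \<Longrightarrow> (g has_real_derivative g' x) (at x)"
    and g' [measurable]: "g' \<in> borel_measurable borel" and g [measurable]: "g \<in> borel_measurable borel"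
    and pos: "\<And>x. x \<in> D \<Longrightarrow> 0 \<le> g' x"
    and f [measurable]: "f \<in> borel_measurable borel"
  shows "(\<integral>\<^sup>+v. f v \<partial>lborel) = (\<integral>\<^sup>+x. ennreal (g' x) * indicator D x * f (g x) \<partial>lborel)"
proof -
  note [measurable] = D(2)
  define M where "M = distr (density lborel (\<lambda>x. ennreal (g' x) * indicator D x)) borel g"
  have "lborel = M"
  proof (rule lborel_eqI, goal_cases)
    case (1 l u)
    then have lu: "l \<le> u" by simp
    obtain x y where x: "x \<in> D" "g x = l" and y: "y \<in> D" "g y = u"
      using onto by (metis UNIV_I imageE)
    have xy: "x \<le> y"
    proof (rule ccontr)
      assume "\<not> x \<le> y"
      then have "g y < g x" using strict_mono_onD[OF mono y(1) x(1)] by simp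
      with x y lu show False by simp
    qed
    have sub: "{x..y} \<subseteq> D"
      using D(1) x(1) y(1) unfolding is_interval_1 subset_iff atLeastAtMost_iff by blast
    have pre: "z \<in> D \<and> g z \<in> {l<..<u} \<longleftrightarrow> z \<in> {x<..<y}" for z
    proof -
      have "(l < g z \<longleftrightarrow> x < z) \<and> (g z < u \<longleftrightarrow> z < y)" if "z \<in> D"
        using strict_mono_on_less[OF mono x(1) that] strict_mono_on_less[OF mono that y(1)] x y by simp
      moreover have "z \<in> D" if "z \<in> {x<..<y}" using sub that by auto
      ultimately show ?thesis by auto
    qed
    have "emeasure M {l<..<u} = (\<integral>\<^sup>+z. indicator {l<..<u} z \<partial>M)" by (simp add: M_def)
    also have "\<dots> = (\<integral>\<^sup>+z. ennreal (g' z) * indicator D z * indicator {l<..<u} (g z) \<partial>lborel)"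
      unfolding M_def by (subst nn_integral_distr, simp, simp, subst nn_integral_density) simp_all
    also have "\<dots> = (\<integral>\<^sup>+z. ennreal (g' z) * indicator {x..y} z \<partial>lborel)"
    proof (intro nn_integral_cong_AE)
      have "AE z in lborel. z \<noteq> x \<and> z \<noteq> y"
        using AE_lborel_singleton[of x] AE_lborel_singleton[of y] by eventually_elim simp
      then show "AE z in lborel. ennreal (g' z) * indicator D z * indicator {l<..<u} (g z)
          = ennreal (g' z) * indicator {x..y} z"
      proof eventually_elim
        case (elim z)
        have "z \<in> D \<and> g z \<in> {l<..<u} \<longleftrightarrow> z \<in> {x..y}"
          using pre[of z] elim by auto
        then show ?case by (auto simp: indicator_def)
      qed
    qed
    also have "\<dots> = ennreal (g y - g x)"
    proof (rule nn_integral_FTC_Icc[OF _ _ _ xy])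
      fix z assume "z \<in> {x..y}"
      then have "z \<in> D" using sub by auto
      then show "DERIV g z :> g' z" "0 \<le> g' z"
        using deriv pos by auto
    qed (rule g')
    finally show ?case
      using x y lu by (simp add: box_real)
  qed (simp add: M_def)
  then have "(\<integral>\<^sup>+v. f v \<partial>lborel) = (\<integral>\<^sup>+v. f v \<partial>M)" by simp
  then show ?thesis by (simp add: M_def nn_integral_distr nn_integral_density)
qed

text \<open>
This is the previous lemma for the logarithm, which maps the positive half line onto the reals.
Scalings and powers of the integration variable become affine maps on the right-hand side.
\<close>
lemma nn_integral_exp_substitution:
  fixes f :: "real \<Rightarrow> ennreal"
  assumes [measurable]: "f \<in> borel_measurable borel"
  shows "(\<integral>\<^sup>+x. indicator {0<..} x * f x \<partial>lborel) = (\<integral>\<^sup>+y. ennreal (exp y) * f (exp y) \<partial>lborel)"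
proof -
  have "(\<integral>\<^sup>+y. ennreal (exp y) * f (exp y) \<partial>lborel)
    = (\<integral>\<^sup>+x. ennreal (1 / x) * indicator {0<..} x * (ennreal (exp (ln x)) * f (exp (ln x))) \<partial>lborel)"
  proof (rule nn_integral_substitution_onto_reals)
    show "ln ` {0<..} = (UNIV :: real set)"
    proof -
      have "y \<in> ln ` {0<..}" for y :: real
        by (rule image_eqI[of _ _ "exp y"]) simp_all
      then show ?thesis by auto
    qed
    show "strict_mono_on {0<..} (ln :: real \<Rightarrow> real)"
      by (auto simp: strict_mono_on_def)
  qed (auto intro!: derivative_eq_intros simp: is_interval_1)
  also have "\<dots> = (\<integral>\<^sup>+x. indicator {0<..} x * f x \<partial>lborel)"
  proof (rule nn_integral_cong)
    fix x :: real
    show "ennreal (1 / x) * indicator {0<..} x * (ennreal (exp (ln x)) * f (exp (ln x))) = indicator {0<..} x * f x"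
    proof (cases "x > 0")
      case True
      then have "ennreal (1 / x) * ennreal x = 1" by (simp add: ennreal_mult'[symmetric])
      then show ?thesis using True by (simp add: mult.assoc[symmetric])
    qed simp
  qed
  finally show ?thesis by simp
qed

lemma nn_integral_square_substitution:
  fixes f :: "real \<Rightarrow> ennreal"
  assumes [measurable]: "f \<in> borel_measurable borel"
  shows "(\<integral>\<^sup>+x. indicator {0<..} x * f x \<partial>lborel) = (\<integral>\<^sup>+z. indicator {0<..} z * (ennreal (2 * z) * f (z\<^sup>2)) \<partial>lborel)"
proof -
  have "(\<integral>\<^sup>+x. indicator {0<..} x * f x \<partial>lborel) = (\<integral>\<^sup>+y. ennreal (exp y) * f (exp y) \<partial>lborel)"
    by (rule nn_integral_exp_substitution) simp
  also have "\<dots> = ennreal \<bar>2\<bar> * (\<integral>\<^sup>+y. ennreal (exp (0 + 2 * y)) * f (exp (0 + 2 * y)) \<partial>lborel)"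
    by (rule nn_integral_real_affine) auto
  also have "\<dots> = (\<integral>\<^sup>+y. ennreal 2 * (ennreal (exp (0 + 2 * y)) * f (exp (0 + 2 * y))) \<partial>lborel)"
    by (subst nn_integral_cmult) simp_all
  also have "\<dots> = (\<integral>\<^sup>+y. ennreal (exp y) * (ennreal (2 * exp y) * f ((exp y)\<^sup>2)) \<partial>lborel)"
  proof (rule nn_integral_cong)
    fix y :: real
    have e: "exp (0 + 2 * y) = exp y * exp y" by (simp add: exp_add[symmetric])
    show "ennreal 2 * (ennreal (exp (0 + 2 * y)) * f (exp (0 + 2 * y))) = ennreal (exp y) * (ennreal (2 * exp y) * f ((exp y)\<^sup>2))"
      unfolding e power2_eq_square by (simp add: ennreal_mult mult_ac)
  qed
  also have "\<dots> = (\<integral>\<^sup>+z. indicator {0<..} z * (ennreal (2 * z) * f (z\<^sup>2)) \<partial>lborel)"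
    by (rule nn_integral_exp_substitution[symmetric]) simp
  finally show ?thesis .
qed

lemma nn_integral_symmetric_cauchy_power:
  assumes "c > 0"
  shows "(\<integral>\<^sup>+v. ennreal ((v\<^sup>2 + c\<^sup>2) powr (- a - 1/2)) \<partial>lborel)
    = ennreal (c powr (- (2 * a))) * (\<integral>\<^sup>+v. ennreal ((v\<^sup>2 + 1) powr (- a - 1/2)) \<partial>lborel)"
proof -
  have "(\<integral>\<^sup>+v. ennreal ((v\<^sup>2 + c\<^sup>2) powr (- a - 1/2)) \<partial>lborel)
    = ennreal \<bar>c\<bar> * (\<integral>\<^sup>+v. ennreal (((0 + c * v)\<^sup>2 + c\<^sup>2) powr (- a - 1/2)) \<partial>lborel)"
    using assms by (intro nn_integral_real_affine) auto
  also have "\<dots> = (\<integral>\<^sup>+v. ennreal c * ennreal (((0 + c * v)\<^sup>2 + c\<^sup>2) powr (- a - 1/2)) \<partial>lborel)"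
    using assms by (subst nn_integral_cmult) simp_all
  also have "\<dots> = (\<integral>\<^sup>+v. ennreal (c powr (- (2 * a))) * ennreal ((v\<^sup>2 + 1) powr (- a - 1/2)) \<partial>lborel)"
  proof (rule nn_integral_cong)
    fix v :: real
    have "(0 + c * v)\<^sup>2 + c\<^sup>2 = c powr 2 * (v\<^sup>2 + 1)"
      using assms by (simp add: powr_numeral power_mult_distrib algebra_simps)
    then have "((0 + c * v)\<^sup>2 + c\<^sup>2) powr (- a - 1/2) = c powr (- (2 * a) - 1) * (v\<^sup>2 + 1) powr (- a - 1/2)"
      using assms by (simp only: powr_mult powr_powr) (simp add: algebra_simps)
    moreover have "c * c powr (- (2 * a) - 1) = c powr (- (2 * a))"
      using assms by (simp add: powr_diff)
    ultimately have "c * ((0 + c * v)\<^sup>2 + c\<^sup>2) powr (- a - 1/2) = c powr (- (2 * a)) * (v\<^sup>2 + 1) powr (- a - 1/2)"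
      by (simp only: mult.assoc[symmetric])
    then show "ennreal c * ennreal (((0 + c * v)\<^sup>2 + c\<^sup>2) powr (- a - 1/2))
      = ennreal (c powr (- (2 * a))) * ennreal ((v\<^sup>2 + 1) powr (- a - 1/2))"
      using assms by (simp only: ennreal_mult[symmetric] powr_ge_zero less_imp_le)
  qed
  also have "\<dots> = ennreal (c powr (- (2 * a))) * (\<integral>\<^sup>+v. ennreal ((v\<^sup>2 + 1) powr (- a - 1/2)) \<partial>lborel)"
    by (rule nn_integral_cmult) simp
  finally show ?thesis .
qed

section \<open>Products and ratios of independent variables\<close>

lemma sets_ratio_law [simp, measurable_cong]: "sets (ratio_law \<mu> \<nu>) = sets borel"
  by (simp add: ratio_law_def)

lemma sets_mult_law [simp, measurable_cong]: "sets (mult_law \<mu> \<nu>) = sets borel"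
  by (simp add: mult_law_def)

lemma nn_integral_ratio_law:
  assumes "prob_space \<mu>" "prob_space \<nu>" and [measurable_cong]: "sets \<mu> = sets borel" "sets \<nu> = sets borel"
    and [measurable]: "f \<in> borel_measurable borel"
  shows "(\<integral>\<^sup>+z. f z \<partial>ratio_law \<mu> \<nu>) = (\<integral>\<^sup>+y. \<integral>\<^sup>+x. f (x / y) \<partial>\<mu> \<partial>\<nu>)"
proof -
  interpret M: prob_space \<mu> by fact
  interpret N: prob_space \<nu> by fact
  interpret pair_sigma_finite \<mu> \<nu> ..
  have "(\<integral>\<^sup>+z. f z \<partial>ratio_law \<mu> \<nu>) = (\<integral>\<^sup>+z. f (fst z / snd z) \<partial>(\<mu> \<Otimes>\<^sub>M \<nu>))"
    unfolding ratio_law_def by (subst nn_integral_distr) (auto simp: case_prod_beta)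
  also have "\<dots> = (\<integral>\<^sup>+y. \<integral>\<^sup>+x. f (x / y) \<partial>\<mu> \<partial>\<nu>)"
    by (subst nn_integral_snd[symmetric]) simp_all
  finally show ?thesis .
qed

lemma nn_integral_mult_law:
  assumes "prob_space \<mu>" "prob_space \<nu>" and [measurable_cong]: "sets \<mu> = sets borel" "sets \<nu> = sets borel"
    and [measurable]: "f \<in> borel_measurable borel"
  shows "(\<integral>\<^sup>+z. f z \<partial>mult_law \<mu> \<nu>) = (\<integral>\<^sup>+x. \<integral>\<^sup>+y. f (x * y) \<partial>\<nu> \<partial>\<mu>)"
proof -
  interpret M: prob_space \<mu> by fact
  interpret N: prob_space \<nu> by fact
  have "(\<integral>\<^sup>+z. f z \<partial>mult_law \<mu> \<nu>) = (\<integral>\<^sup>+z. f (fst z * snd z) \<partial>(\<mu> \<Otimes>\<^sub>M \<nu>))"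
    unfolding mult_law_def by (subst nn_integral_distr) (auto simp: case_prod_beta)
  also have "\<dots> = (\<integral>\<^sup>+x. \<integral>\<^sup>+y. f (x * y) \<partial>\<nu> \<partial>\<mu>)"
    by (subst N.nn_integral_fst[symmetric]) simp_all
  finally show ?thesis .
qed

lemma prob_space_ratio_law:
  assumes "prob_space \<mu>" "prob_space \<nu>" "sets \<mu> = sets borel" "sets \<nu> = sets borel"
  shows "prob_space (ratio_law \<mu> \<nu>)"
  using nn_integral_ratio_law[OF assms, of "\<lambda>_. 1"] assms
  by (intro prob_spaceI) (simp add: prob_space.emeasure_space_1)

lemma prob_space_mult_law:
  assumes "prob_space \<mu>" "prob_space \<nu>" "sets \<mu> = sets borel" "sets \<nu> = sets borel"
  shows "prob_space (mult_law \<mu> \<nu>)"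
  using nn_integral_mult_law[OF assms, of "\<lambda>_. 1"] assms
  by (intro prob_spaceI) (simp add: prob_space.emeasure_space_1)

text \<open>
With \<open>x = u y\<close> in the numerator, the integral over the denominator \<open>y\<close> becomes a gamma integral of
shape \<open>a + b\<close> and rate \<open>1 + u\<close>. The result is the beta prime density.
\<close>
lemma nn_integral_ratio_of_gammas:
  assumes a: "a > 0" and b: "b > 0" and [measurable]: "f \<in> borel_measurable borel"
  shows "(\<integral>\<^sup>+x. f x \<partial>ratio_law (gamma_law a) (gamma_law b))
    = (\<integral>\<^sup>+u. indicator {0<..} u * (ennreal (u powr (a - 1) * (1 + u) powr (- (a + b)) / Beta a b) * f u) \<partial>lborel)"
proof -
  define d where "d p x = (if 0 < x then x powr (p - 1) * exp (- x) / Gamma p else 0)" for p x :: real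
  have [measurable]: "d p \<in> borel_measurable borel" for p
    unfolding d_def by measurable
  define h where "h u y = (if 0 < y then y powr (a + b - 1) * exp (- ((1 + u) * y)) else 0)" for u y :: real
  have [measurable]: "(\<lambda>(u, y). h u y) \<in> borel_measurable (borel \<Otimes>\<^sub>M borel)"
    unfolding h_def by measurable
  define q where "q u = (if 0 < u then u powr (a - 1) / (Gamma a * Gamma b) else 0)" for u :: real
  have [measurable]: "q \<in> borel_measurable borel" unfolding q_def by measurable
  have G: "Gamma a > 0" "Gamma b > 0" "Gamma (a + b) > 0"
    using a b by (auto intro: Gamma_real_pos)
  have "(\<integral>\<^sup>+x. f x \<partial>ratio_law (gamma_law a) (gamma_law b)) = (\<integral>\<^sup>+y. \<integral>\<^sup>+x. f (x / y) \<partial>gamma_law a \<partial>gamma_law b)"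
    by (rule nn_integral_ratio_law) simp_all
  also have "\<dots> = (\<integral>\<^sup>+y. \<integral>\<^sup>+x. ennreal (d a x) * f (x / y) \<partial>lborel \<partial>gamma_law b)"
    by (intro nn_integral_cong) (simp add: nn_integral_gamma_law[OF a] d_def)
  also have "\<dots> = (\<integral>\<^sup>+y. ennreal (d b y) * (\<integral>\<^sup>+x. ennreal (d a x) * f (x / y) \<partial>lborel) \<partial>lborel)"
    unfolding d_def[of b] by (rule nn_integral_gamma_law[OF b]) measurable
  also have "\<dots> = (\<integral>\<^sup>+y. \<integral>\<^sup>+u. ennreal (q u) * f u * ennreal (h u y) \<partial>lborel \<partial>lborel)"
  proof (rule nn_integral_cong)
    fix y :: real
    show "ennreal (d b y) * (\<integral>\<^sup>+x. ennreal (d a x) * f (x / y) \<partial>lborel)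
      = (\<integral>\<^sup>+u. ennreal (q u) * f u * ennreal (h u y) \<partial>lborel)"
    proof (cases "y > 0")
      case y: True
      have "(\<integral>\<^sup>+x. ennreal (d a x) * f (x / y) \<partial>lborel)
        = ennreal \<bar>y\<bar> * (\<integral>\<^sup>+u. ennreal (d a (0 + y * u)) * f ((0 + y * u) / y) \<partial>lborel)"
        using y by (intro nn_integral_real_affine) auto
      also have "\<dots> = ennreal y * (\<integral>\<^sup>+u. ennreal (d a (y * u)) * f u \<partial>lborel)"
        using y by simp
      also have "ennreal (d b y) * \<dots> = (\<integral>\<^sup>+u. ennreal (d b y * y) * (ennreal (d a (y * u)) * f u) \<partial>lborel)"
      proof -
        have "ennreal (d b y) * ennreal y = ennreal (d b y * y)"
          using y G by (intro ennreal_mult[symmetric]) (simp_all add: d_def)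
        then show ?thesis
          by (subst nn_integral_cmult) (simp_all only: mult.assoc[symmetric], measurable)
      qed
      also have "\<dots> = (\<integral>\<^sup>+u. ennreal (q u) * f u * ennreal (h u y) \<partial>lborel)"
      proof (rule nn_integral_cong)
        fix u :: real
        have "d b y * y * d a (y * u) = q u * h u y"
        proof (cases "u > 0")
          case True
          have "y powr (b - 1) * y = y powr b" using y by (simp add: powr_diff)
          moreover have "(y * u) powr (a - 1) = y powr (a - 1) * u powr (a - 1)"
            using True y by (simp add: powr_mult)
          moreover have "y powr b * y powr (a - 1) = y powr (a + b - 1)"
            by (simp add: powr_add[symmetric] algebra_simps)
          moreover have "exp (- y) * exp (- (y * u)) = exp (- ((1 + u) * y))"
            by (simp add: exp_add[symmetric] algebra_simps)
          moreover have "d b y * y * d a (y * u)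
            = (y powr (b - 1) * y) * (y * u) powr (a - 1) * (exp (- y) * exp (- (y * u))) / (Gamma a * Gamma b)"
            using True y by (simp add: d_def mult_ac)
          ultimately show ?thesis
            using True y by (simp add: q_def h_def mult_ac)
        next
          case False
          then show ?thesis using y by (simp add: d_def q_def zero_less_mult_iff)
        qed
        then have 1: "ennreal (d b y * y * d a (y * u)) = ennreal (q u * h u y)" by simp
        have 2: "ennreal (d b y * y) * ennreal (d a (y * u)) = ennreal (d b y * y * d a (y * u))"
          using y G by (intro ennreal_mult[symmetric]) (auto simp: d_def)
        have 3: "ennreal (q u) * ennreal (h u y) = ennreal (q u * h u y)"
          using G by (intro ennreal_mult[symmetric]) (auto simp: q_def h_def)
        have "ennreal (d b y * y) * (ennreal (d a (y * u)) * f u) = ennreal (q u) * ennreal (h u y) * f u"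
          unfolding mult.assoc[symmetric] 2 1 3 ..
        also have "\<dots> = ennreal (q u) * f u * ennreal (h u y)" by (simp only: mult_ac)
        finally show "ennreal (d b y * y) * (ennreal (d a (y * u)) * f u) = ennreal (q u) * f u * ennreal (h u y)" .
      qed
      finally show ?thesis .
    qed (simp add: d_def h_def)
  qed
  also have "\<dots> = (\<integral>\<^sup>+u. \<integral>\<^sup>+y. ennreal (q u) * f u * ennreal (h u y) \<partial>lborel \<partial>lborel)"
    by (rule lborel_pair.Fubini') measurable
  also have "\<dots> = (\<integral>\<^sup>+u. indicator {0<..} u * (ennreal (u powr (a - 1) * (1 + u) powr (- (a + b)) / Beta a b) * f u) \<partial>lborel)"
  proof (rule nn_integral_cong)
    fix u :: real
    have m: "(\<integral>\<^sup>+y. ennreal (q u) * f u * ennreal (h u y) \<partial>lborel) = ennreal (q u) * f u * (\<integral>\<^sup>+y. ennreal (h u y) \<partial>lborel)"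
      by (rule nn_integral_cmult) (simp add: h_def)
    show "(\<integral>\<^sup>+y. ennreal (q u) * f u * ennreal (h u y) \<partial>lborel)
      = indicator {0<..} u * (ennreal (u powr (a - 1) * (1 + u) powr (- (a + b)) / Beta a b) * f u)"
    proof (cases "u > 0")
      case True
      have "(\<integral>\<^sup>+y. ennreal (h u y) \<partial>lborel) = ennreal (Gamma (a + b) / (1 + u) powr (a + b))"
        unfolding h_def using True a b by (intro nn_integral_Gamma_scaled) auto
      moreover have "ennreal (q u) * ennreal (Gamma (a + b) / (1 + u) powr (a + b))
        = ennreal (u powr (a - 1) * (1 + u) powr (- (a + b)) / Beta a b)"
      proof -
        have "q u * (Gamma (a + b) / (1 + u) powr (a + b)) = u powr (a - 1) * (1 + u) powr (- (a + b)) / Beta a b"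
          using True G unfolding powr_minus[of "1 + u" "a + b"] by (simp add: q_def Beta_def field_simps)
        moreover have "q u \<ge> 0" "Gamma (a + b) / (1 + u) powr (a + b) \<ge> 0"
          using G by (auto simp: q_def)
        ultimately show ?thesis by (simp only: ennreal_mult[symmetric])
      qed
      ultimately show ?thesis using True unfolding m by (simp add: mult_ac)
    qed (simp add: m q_def)
  qed
  finally show ?thesis .
qed

section \<open>The logarithmic moment of a ratio of two half-gamma variables\<close>

lemma Beta_half_half: "Beta (1/2) (1/2 :: real) = pi"
  by (simp add: Beta_def Gamma_one_half_real)

text \<open>
In the variable \<open>z = \<surd>x\<close> the density \<open>1 / (\<pi> \<surd>x (1 + x))\<close> becomes the half Cauchy density, so
integrals against it are integrals of rational functions.
\<close>
lemma nn_integral_X_half_law: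
  assumes [measurable]: "f \<in> borel_measurable borel"
  shows "(\<integral>\<^sup>+x. f x \<partial>X_half_law)
    = (\<integral>\<^sup>+z. indicator {0<..} z * (ennreal (2 / (pi * (1 + z\<^sup>2))) * f (z\<^sup>2)) \<partial>lborel)"
proof -
  have "(\<integral>\<^sup>+x. f x \<partial>X_half_law)
    = (\<integral>\<^sup>+u. indicator {0<..} u * (ennreal (u powr (1/2 - 1) * (1 + u) powr (- (1/2 + 1/2)) / Beta (1/2) (1/2)) * f u) \<partial>lborel)"
    unfolding X_half_law_def by (rule nn_integral_ratio_of_gammas) auto
  also have "\<dots> = (\<integral>\<^sup>+z. indicator {0<..} z * (ennreal (2 * z) * (ennreal ((z\<^sup>2) powr (1/2 - 1) *
      (1 + z\<^sup>2) powr (- (1/2 + 1/2)) / Beta (1/2) (1/2)) * f (z\<^sup>2))) \<partial>lborel)"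
    by (rule nn_integral_square_substitution) measurable
  also have "\<dots> = (\<integral>\<^sup>+z. indicator {0<..} z * (ennreal (2 / (pi * (1 + z\<^sup>2))) * f (z\<^sup>2)) \<partial>lborel)"
  proof (rule nn_integral_cong)
    fix z :: real
    have "ennreal (2 * z) * ennreal ((z\<^sup>2) powr (1/2 - 1) * (1 + z\<^sup>2) powr (- (1/2 + 1/2)) / Beta (1/2) (1/2))
      = ennreal (2 / (pi * (1 + z\<^sup>2)))" if z: "z > 0"
    proof -
      have 1: "(z\<^sup>2) powr (1/2 - 1) = 1 / z"
        using z by (simp add: powr_minus powr_half_sqrt field_simps)
      have 2: "(1 + z\<^sup>2) powr (- (1/2 + 1/2)) = 1 / (1 + z\<^sup>2)"
        by (simp add: powr_minus field_simps add_nonneg_eq_0_iff)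
      show ?thesis
        unfolding 1 2 Beta_half_half using z by (simp add: ennreal_mult[symmetric] mult.commute)
    qed
    then show "indicator {0<..} z * (ennreal (2 * z) * (ennreal ((z\<^sup>2) powr (1/2 - 1) *
        (1 + z\<^sup>2) powr (- (1/2 + 1/2)) / Beta (1/2) (1/2)) * f (z\<^sup>2)))
      = indicator {0<..} z * (ennreal (2 / (pi * (1 + z\<^sup>2))) * f (z\<^sup>2))"
      by (cases "z > 0") (simp_all add: mult.assoc[symmetric])
  qed
  finally show ?thesis .
qed

text \<open>
This is the derivative of \<open>E log (1 + \<rho>\<^sup>2 X)\<close> in \<open>\<rho>\<close>. Partial fractions give an arctangent
antiderivative, with the denominator \<open>1 - \<rho>\<^sup>2\<close>.
\<close>
lemma nn_integral_ln_kernel: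
  fixes \<rho> :: real
  assumes \<rho>: "\<rho> > 0" "\<rho> \<noteq> 1"
  shows "(\<integral>\<^sup>+z. indicator {0<..} z * ennreal (2 / (pi * (1 + z\<^sup>2)) * (2 * \<rho> * z\<^sup>2 / (1 + \<rho>\<^sup>2 * z\<^sup>2))) \<partial>lborel)
    = ennreal (2 / (1 + \<rho>))"
proof -
  let ?h = "\<lambda>z. 2 / (pi * (1 + z\<^sup>2)) * (2 * \<rho> * z\<^sup>2 / (1 + \<rho>\<^sup>2 * z\<^sup>2))"
  define K where "K = 4 * \<rho> / (pi * (1 - \<rho>\<^sup>2))"
  define F where "F z = K * (arctan (\<rho> * z) / \<rho> - arctan z)" for z
  have r: "1 - \<rho>\<^sup>2 \<noteq> 0" using \<rho> by (simp add: power2_eq_1_iff)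
  have "(\<integral>\<^sup>+z. indicator {0<..} z * ennreal (?h z) \<partial>lborel) = (\<integral>\<^sup>+z. ennreal (?h z) * indicator {0..} z \<partial>lborel)"
    by (intro nn_integral_cong) (auto simp: indicator_def)
  also have "\<dots> = ennreal (2 / (1 + \<rho>) - F 0)"
  proof (rule nn_integral_FTC_atLeast)
    show "?h \<in> borel_measurable borel" by measurable
    fix z :: real
    have p: "1 + \<rho>\<^sup>2 * z\<^sup>2 > 0" "1 + z\<^sup>2 > 0" by (auto intro!: add_pos_nonneg)
    have "DERIV F z :> K * ((1 / (1 + (\<rho> * z)\<^sup>2)) * \<rho> / \<rho> - 1 / (1 + z\<^sup>2))"
      unfolding F_def using \<rho>
      by (auto intro!: derivative_eq_intros simp: inverse_eq_divide)
    also have "K * ((1 / (1 + (\<rho> * z)\<^sup>2)) * \<rho> / \<rho> - 1 / (1 + z\<^sup>2)) = K * (((1 - \<rho>\<^sup>2) * z\<^sup>2) / ((1 + \<rho>\<^sup>2 * z\<^sup>2) * (1 + z\<^sup>2)))"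
      using \<rho> p by (simp add: power_mult_distrib divide_simps) (simp add: algebra_simps)
    also have "\<dots> = ?h z"
    proof -
      have "K * (1 - \<rho>\<^sup>2) = 4 * \<rho> / pi" using r by (simp add: K_def)
      then have "K * (((1 - \<rho>\<^sup>2) * z\<^sup>2) / ((1 + \<rho>\<^sup>2 * z\<^sup>2) * (1 + z\<^sup>2))) = 4 * \<rho> / pi * (z\<^sup>2 / ((1 + \<rho>\<^sup>2 * z\<^sup>2) * (1 + z\<^sup>2)))"
        by (metis mult.assoc times_divide_eq_right)
      then show ?thesis by (simp add: mult_ac)
    qed
    finally show "DERIV F z :> ?h z" .
    show "0 \<le> ?h z" using \<rho> p by (intro mult_nonneg_nonneg divide_nonneg_nonneg) auto
  next
    have "((\<lambda>z. arctan (\<rho> * z)) \<longlongrightarrow> pi / 2) at_top"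
      by (rule filterlim_compose[OF tendsto_arctan_at_top])
        (rule filterlim_tendsto_pos_mult_at_top[OF tendsto_const \<rho>(1) filterlim_ident])
    then have "(F \<longlongrightarrow> K * (pi / 2 / \<rho> - pi / 2)) at_top"
      unfolding F_def by (intro tendsto_intros tendsto_arctan_at_top) (use \<rho> in auto)
    moreover have "K * (pi / 2 / \<rho> - pi / 2) = 2 / (1 + \<rho>)"
    proof -
      have "K * (pi / 2 / \<rho> - pi / 2) = 2 * (1 - \<rho>) / (1 - \<rho>\<^sup>2)"
        using \<rho> r unfolding K_def by (simp add: field_simps)
      also have "1 - \<rho>\<^sup>2 = (1 - \<rho>) * (1 + \<rho>)" by (simp add: power2_eq_square algebra_simps)
      also have "2 * (1 - \<rho>) / ((1 - \<rho>) * (1 + \<rho>)) = 2 / (1 + \<rho>)"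
        using \<rho> by (simp add: divide_simps)
      finally show ?thesis .
    qed
    ultimately show "(F \<longlongrightarrow> 2 / (1 + \<rho>)) at_top" by simp
  qed
  finally show ?thesis by (simp add: F_def)
qed

text \<open>
The logarithm is the integral of its derivative in \<open>r\<close>; after exchanging the integrals, the derivative
of the expectation is \<open>2 / (1 + \<rho>)\<close>.
\<close>
lemma X_half_law_log_moment:
  fixes r :: real
  assumes r: "r \<ge> 0"
  shows "(\<integral>\<^sup>+x. ennreal (ln (1 + r\<^sup>2 * x)) \<partial>X_half_law) = ennreal (2 * ln (1 + r))"
proof -
  let ?k = "\<lambda>z \<rho> :: real. 2 * \<rho> * z\<^sup>2 / (1 + \<rho>\<^sup>2 * z\<^sup>2)"
  let ?w = "\<lambda>z :: real. 2 / (pi * (1 + z\<^sup>2))"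
  have w: "?w z \<ge> 0" for z by (intro divide_nonneg_nonneg mult_nonneg_nonneg) auto
  have ln_eq: "ennreal (ln (1 + r\<^sup>2 * z\<^sup>2)) = (\<integral>\<^sup>+\<rho>. ennreal (?k z \<rho>) * indicator {0..r} \<rho> \<partial>lborel)" for z :: real
  proof -
    have "(\<integral>\<^sup>+\<rho>. ennreal (?k z \<rho>) * indicator {0..r} \<rho> \<partial>lborel) = ennreal (ln (1 + r\<^sup>2 * z\<^sup>2) - ln (1 + 0\<^sup>2 * z\<^sup>2))"
    proof (rule nn_integral_FTC_Icc[OF _ _ _ r])
      show "?k z \<in> borel_measurable borel" by measurable
      fix \<rho> :: real assume \<rho>: "\<rho> \<in> {0..r}"
      have p: "1 + \<rho>\<^sup>2 * z\<^sup>2 > 0" by (auto intro!: add_pos_nonneg)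
      then show "DERIV (\<lambda>\<rho>. ln (1 + \<rho>\<^sup>2 * z\<^sup>2)) \<rho> :> ?k z \<rho>"
        by (auto intro!: derivative_eq_intros simp: divide_inverse)
      show "0 \<le> ?k z \<rho>" using \<rho> p by (intro divide_nonneg_nonneg) auto
    qed
    then show ?thesis by simp
  qed
  have "(\<integral>\<^sup>+x. ennreal (ln (1 + r\<^sup>2 * x)) \<partial>X_half_law)
    = (\<integral>\<^sup>+z. indicator {0<..} z * (ennreal (?w z) * ennreal (ln (1 + r\<^sup>2 * z\<^sup>2))) \<partial>lborel)"
    by (rule nn_integral_X_half_law) measurable
  also have "\<dots> = (\<integral>\<^sup>+z. \<integral>\<^sup>+\<rho>. indicator {0<..} z * (ennreal (?w z) * (ennreal (?k z \<rho>) * indicator {0..r} \<rho>)) \<partial>lborel \<partial>lborel)"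
    unfolding ln_eq by (intro nn_integral_cong) (simp add: nn_integral_cmult)
  also have "\<dots> = (\<integral>\<^sup>+\<rho>. \<integral>\<^sup>+z. indicator {0<..} z * (ennreal (?w z) * (ennreal (?k z \<rho>) * indicator {0..r} \<rho>)) \<partial>lborel \<partial>lborel)"
    by (rule lborel_pair.Fubini') measurable
  also have "\<dots> = (\<integral>\<^sup>+\<rho>. ennreal (2 / (1 + \<rho>)) * indicator {0..r} \<rho> \<partial>lborel)"
  proof (rule nn_integral_cong_AE)
    \<comment> \<open>The antiderivative of the inner integrand degenerates at 0 and at 1.\<close>
    have "AE \<rho> in lborel. \<rho> \<noteq> (0::real) \<and> \<rho> \<noteq> 1"
      using AE_lborel_singleton[of "0::real"] AE_lborel_singleton[of "1::real"] by eventually_elim simp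
    then show "AE \<rho> in lborel. (\<integral>\<^sup>+z. indicator {0<..} z * (ennreal (?w z) * (ennreal (?k z \<rho>) * indicator {0..r} \<rho>)) \<partial>lborel)
        = ennreal (2 / (1 + \<rho>)) * indicator {0..r} \<rho>"
    proof eventually_elim
      case (elim \<rho>)
      show ?case
      proof (cases "\<rho> \<in> {0..r}")
        case True
        with elim have \<rho>: "\<rho> > 0" "\<rho> \<noteq> 1" by auto
        have "ennreal (?w z) * ennreal (?k z \<rho>) = ennreal (?w z * ?k z \<rho>)" for z
          using w \<rho> by (intro ennreal_mult[symmetric] divide_nonneg_nonneg) auto
        then show ?thesis
          using True nn_integral_ln_kernel[OF \<rho>] by simp
      qed simp
    qed
  qed
  also have "\<dots> = ennreal (2 * ln (1 + r) - 2 * ln (1 + 0))"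
    by (rule nn_integral_FTC_Icc[OF _ _ _ r]) (auto intro!: derivative_eq_intros simp: divide_inverse)
  finally show ?thesis by simp
qed

section \<open>The Stieltjes transform of the gamma ratios\<close>

text \<open>
The integrand is a power of \<open>(1 + x) (1 + r\<^sup>2 x)\<close>, which the inversion \<open>x \<mapsto> 1 / (r\<^sup>2 x)\<close> preserves
up to a monomial factor. In the coordinate \<open>x = e\<^bsup>2t\<^esup> / r\<close> the inversion is \<open>t \<mapsto> -t\<close>, and the product
is \<open>e\<^bsup>2t\<^esup> (v\<^sup>2 + c\<^sup>2)\<close> with \<open>v = e\<^bsup>t\<^esup> - e\<^bsup>-t\<^esup>\<close> and \<open>c = \<surd>r + 1 / \<surd>r\<close>. Averaging the integral with its
reflection produces exactly \<open>dv\<close>, so \<open>r\<close> enters only through a power of \<open>c\<close> and a prefactor, which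
combine to a power of \<open>1 + r\<close>.
\<close>
lemma gamma_ratio_half_stieltjes_up_to_constant:
  fixes a r :: real
  assumes a: "a > 0" and r: "r > 0"
  shows "(\<integral>\<^sup>+x. ennreal ((1 + r\<^sup>2 * x) powr (- (a + 1/2))) \<partial>ratio_law (gamma_law a) (gamma_law (1/2)))
    = ennreal ((1 + r) powr (- (2 * a))) * (ennreal (1 / Beta a (1/2)) * (\<integral>\<^sup>+v. ennreal ((v\<^sup>2 + 1) powr (- a - 1/2)) \<partial>lborel))"
proof -
  define B where "B = Beta a (1/2)"
  have B: "B > 0" using a by (simp add: B_def Beta_def Gamma_real_pos)
  define c where "c = sqrt r + 1 / sqrt r"
  have c: "c > 0" using r by (simp add: c_def add_pos_pos)
  have c2: "c\<^sup>2 = r + 1 / r + 2"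
    using r by (simp add: c_def power2_sum power_divide)
  define \<psi> where "\<psi> v = (v\<^sup>2 + c\<^sup>2) powr (- a - 1/2)" for v
  have [measurable]: "\<psi> \<in> borel_measurable borel" unfolding \<psi>_def by measurable
  have \<psi>_even: "\<psi> (- v) = \<psi> v" and \<psi>_nonneg: "\<psi> v \<ge> 0" for v by (simp_all add: \<psi>_def)
  let ?p = "\<lambda>x. x powr (a - 1) * (1 + x) powr (- (a + 1/2)) / B"
  let ?q = "\<lambda>x. (1 + r\<^sup>2 * x) powr (- (a + 1/2))"
  \<comment> \<open>The shift centres the inversion at \<open>t = 0\<close>, and the factor 2 avoids the half powers of \<open>exp t\<close>.\<close>
  let ?y = "\<lambda>t. - ln r + 2 * t"
  have kernel: "2 * (exp (?y t) * (?p (exp (?y t)) * ?q (exp (?y t)))) = 2 * r powr (- a) / B * (exp (- t) * \<psi> (exp t - exp (- t)))" for t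
  proof -
    define x where "x = exp (?y t)"
    define E where "E = exp (2 * t)"
    have E: "E > 0" by (simp add: E_def)
    have x: "x > 0" by (simp add: x_def)
    have xE: "x = E / r" using r by (simp add: x_def E_def exp_diff)
    have "(exp t - exp (- t))\<^sup>2 = exp t * exp t + exp (- t) * exp (- t) - 2 * (exp t * exp (- t))"
      by (simp add: power2_eq_square algebra_simps)
    also have "exp t * exp (- t) = 1" by (simp add: exp_minus)
    also have "exp t * exp t = E" by (simp add: E_def mult_exp_exp)
    also have "exp (- t) * exp (- t) = 1 / E"
      by (simp add: E_def mult_exp_exp inverse_eq_divide[symmetric] exp_minus[symmetric])
    finally have "(exp t - exp (- t))\<^sup>2 = E + 1 / E - 2" by simp
    then have "(exp t - exp (- t))\<^sup>2 + c\<^sup>2 = E + 1 / E + r + 1 / r" by (simp add: c2)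
    then have *: "(1 + x) * (1 + r\<^sup>2 * x) = E * ((exp t - exp (- t))\<^sup>2 + c\<^sup>2)"
      unfolding xE using r E by (simp add: field_simps power2_eq_square)
    have pos: "(exp t - exp (- t))\<^sup>2 + c\<^sup>2 > 0" using c by (intro add_nonneg_pos) auto
    have "x * (?p x * ?q x) = x powr a * ((1 + x) * (1 + r\<^sup>2 * x)) powr (- (a + 1/2)) / B"
      using x r by (subst powr_mult) (simp_all add: powr_diff)
    also have "\<dots> = (E / r) powr a * E powr (- (a + 1/2)) * \<psi> (exp t - exp (- t)) / B"
      unfolding * \<psi>_def using E pos by (simp add: powr_mult xE)
    also have "(E / r) powr a * E powr (- (a + 1/2)) = r powr (- a) * E powr (- 1/2)"
    proof -
      have "(E / r) powr a = r powr (- a) * E powr a"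
        using E r by (simp add: powr_divide powr_minus field_simps)
      moreover have "E powr a * E powr (- (a + 1/2)) = E powr (- 1/2)"
        unfolding powr_add[symmetric] by simp
      ultimately show ?thesis by (simp only: mult.assoc)
    qed
    also have "E powr (- 1/2) = exp (- t)" by (simp add: E_def powr_def)
    finally show ?thesis unfolding x_def by (simp add: mult_ac)
  qed
  have "(\<integral>\<^sup>+x. ennreal (?q x) \<partial>ratio_law (gamma_law a) (gamma_law (1/2)))
    = (\<integral>\<^sup>+x. indicator {0<..} x * (ennreal (?p x) * ennreal (?q x)) \<partial>lborel)"
    unfolding B_def by (rule nn_integral_ratio_of_gammas) (use a in auto)
  also have "\<dots> = (\<integral>\<^sup>+y. ennreal (exp y) * (ennreal (?p (exp y)) * ennreal (?q (exp y))) \<partial>lborel)"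
    by (rule nn_integral_exp_substitution) measurable
  also have "\<dots> = ennreal \<bar>2\<bar> * (\<integral>\<^sup>+t. ennreal (exp (?y t)) * (ennreal (?p (exp (?y t))) * ennreal (?q (exp (?y t)))) \<partial>lborel)"
    by (rule nn_integral_real_affine) auto
  also have "\<dots> = (\<integral>\<^sup>+t. ennreal \<bar>2\<bar> * (ennreal (exp (?y t)) * (ennreal (?p (exp (?y t))) * ennreal (?q (exp (?y t))))) \<partial>lborel)"
    by (rule nn_integral_cmult[symmetric]) measurable
  also have "\<dots> = (\<integral>\<^sup>+t. ennreal (2 * r powr (- a) / B) * ennreal (exp (- t) * \<psi> (exp t - exp (- t))) \<partial>lborel)"
  proof (rule nn_integral_cong)
    fix t
    have "ennreal \<bar>2\<bar> * (ennreal (exp (?y t)) * (ennreal (?p (exp (?y t))) * ennreal (?q (exp (?y t)))))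
      = ennreal (2 * (exp (?y t) * (?p (exp (?y t)) * ?q (exp (?y t)))))"
    proof -
      have "?p (exp (?y t)) \<ge> 0" "?q (exp (?y t)) \<ge> 0" using B by simp_all
      then show ?thesis
        by (simp only: abs_numeral ennreal_mult[symmetric] exp_ge_zero mult_nonneg_nonneg zero_le_numeral)
    qed
    also have "\<dots> = ennreal (2 * r powr (- a) / B) * ennreal (exp (- t) * \<psi> (exp t - exp (- t)))"
      unfolding kernel using B \<psi>_nonneg by (intro ennreal_mult) auto
    finally show "ennreal \<bar>2\<bar> * (ennreal (exp (?y t)) * (ennreal (?p (exp (?y t))) * ennreal (?q (exp (?y t)))))
      = ennreal (2 * r powr (- a) / B) * ennreal (exp (- t) * \<psi> (exp t - exp (- t)))" .
  qed
  also have "\<dots> = ennreal (2 * r powr (- a) / B) * (\<integral>\<^sup>+t. ennreal (exp (- t) * \<psi> (exp t - exp (- t))) \<partial>lborel)"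
    by (rule nn_integral_cmult) measurable
  also have "\<dots> = ennreal (r powr (- a) / B) * (ennreal 2 * (\<integral>\<^sup>+t. ennreal (exp (- t) * \<psi> (exp t - exp (- t))) \<partial>lborel))"
  proof -
    have "ennreal (2 * r powr (- a) / B) = ennreal (r powr (- a) / B) * ennreal 2"
      using B by (subst ennreal_mult[symmetric]) (simp_all add: mult.commute)
    then show ?thesis by (simp only: mult.assoc)
  qed
  also have "ennreal 2 * (\<integral>\<^sup>+t. ennreal (exp (- t) * \<psi> (exp t - exp (- t))) \<partial>lborel) = (\<integral>\<^sup>+v. ennreal (\<psi> v) \<partial>lborel)"
  proof -
    \<comment> \<open>The function \<open>\<psi>\<close> is even, so the reflection \<open>t \<mapsto> - t\<close> only changes the factor \<open>exp (- t)\<close>.\<close>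
    have refl: "(\<integral>\<^sup>+t. ennreal (exp (- t) * \<psi> (exp t - exp (- t))) \<partial>lborel) = (\<integral>\<^sup>+t. ennreal (exp t * \<psi> (exp t - exp (- t))) \<partial>lborel)"
    proof -
      have "(\<integral>\<^sup>+t. ennreal (exp (- t) * \<psi> (exp t - exp (- t))) \<partial>lborel)
        = ennreal \<bar>- 1\<bar> * (\<integral>\<^sup>+t. ennreal (exp (- (0 + (- 1) * t)) * \<psi> (exp (0 + (- 1) * t) - exp (- (0 + (- 1) * t)))) \<partial>lborel)"
        by (rule nn_integral_real_affine) auto
      also have "\<dots> = (\<integral>\<^sup>+t. ennreal (exp t * \<psi> (- (exp t - exp (- t)))) \<partial>lborel)" by simp
      finally show ?thesis by (simp only: \<psi>_even)
    qed
    have "(\<integral>\<^sup>+v. ennreal (\<psi> v) \<partial>lborel) = (\<integral>\<^sup>+t. ennreal (exp t + exp (- t)) * indicator UNIV t * ennreal (\<psi> (exp t - exp (- t))) \<partial>lborel)"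
    proof (rule nn_integral_substitution_onto_reals)
      show "strict_mono_on UNIV (\<lambda>t::real. exp t - exp (- t))"
        by (auto simp: strict_mono_on_def intro!: diff_strict_mono)
      have "y \<in> range (\<lambda>t::real. exp t - exp (- t))" for y :: real
      proof (rule image_eqI)
        have "sinh (arsinh (y / 2)) = y / 2" by simp
        then show "y = exp (arsinh (y / 2)) - exp (- arsinh (y / 2))" by (simp add: sinh_def)
      qed simp
      then show "range (\<lambda>t::real. exp t - exp (- t)) = UNIV" by auto
    qed (auto intro!: derivative_eq_intros add_nonneg_nonneg)
    also have "\<dots> = (\<integral>\<^sup>+t. ennreal (exp t * \<psi> (exp t - exp (- t))) + ennreal (exp (- t) * \<psi> (exp t - exp (- t))) \<partial>lborel)"
      using \<psi>_nonneg by (intro nn_integral_cong) (simp add: ennreal_mult[symmetric] ennreal_plus[symmetric] distrib_right del: ennreal_plus)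
    also have "\<dots> = (\<integral>\<^sup>+t. ennreal (exp (- t) * \<psi> (exp t - exp (- t))) \<partial>lborel) + (\<integral>\<^sup>+t. ennreal (exp (- t) * \<psi> (exp t - exp (- t))) \<partial>lborel)"
      by (subst nn_integral_add) (simp_all add: refl)
    finally show ?thesis by (simp add: mult_2)
  qed
  also have "(\<integral>\<^sup>+v. ennreal (\<psi> v) \<partial>lborel) = ennreal (c powr (- (2 * a))) * (\<integral>\<^sup>+v. ennreal ((v\<^sup>2 + 1) powr (- a - 1/2)) \<partial>lborel)"
    unfolding \<psi>_def by (rule nn_integral_symmetric_cauchy_power[OF c])
  also have "ennreal (r powr (- a) / B) * (ennreal (c powr (- (2 * a))) * J) = ennreal ((1 + r) powr (- (2 * a))) * (ennreal (1 / B) * J)" for J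
  proof -
    have "r * c\<^sup>2 = (1 + r)\<^sup>2"
      unfolding c2 using r by (simp add: power2_eq_square field_simps)
    then have "(r * c powr 2) powr (- a) = ((1 + r) powr 2) powr (- a)" using r c by (simp add: powr_numeral)
    then have "r powr (- a) * c powr (- (2 * a)) = (1 + r) powr (- (2 * a))"
      unfolding powr_mult powr_powr by simp
    then have "r powr (- a) / B * c powr (- (2 * a)) = (1 + r) powr (- (2 * a)) * (1 / B)" by simp
    then have "ennreal (r powr (- a) / B) * ennreal (c powr (- (2 * a))) = ennreal ((1 + r) powr (- (2 * a))) * ennreal (1 / B)"
      using B by (subst (1 2) ennreal_mult[symmetric]) simp_all
    then show ?thesis by (simp only: mult.assoc[symmetric])
  qed
  finally show ?thesis unfolding B_def .
qed

text \<open>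
The constant in the previous lemma does not depend on \<open>r\<close>; letting \<open>r\<close> tend to 0 identifies it as the
total mass 1.
\<close>
lemma gamma_ratio_half_stieltjes:
  fixes a r :: real
  assumes a: "a > 0" and r: "r \<ge> 0"
  shows "(\<integral>\<^sup>+x. ennreal ((1 + r\<^sup>2 * x) powr (- (a + 1/2))) \<partial>ratio_law (gamma_law a) (gamma_law (1/2)))
    = ennreal ((1 + r) powr (- (2 * a)))"
proof -
  define M where "M = ratio_law (gamma_law a) (gamma_law (1/2))"
  have [measurable_cong]: "sets M = sets borel" by (simp add: M_def)
  interpret M: prob_space M unfolding M_def by (rule prob_space_ratio_law) simp_all
  have M_pos: "AE x in M. 0 \<le> x"
  proof -
    have "(\<integral>\<^sup>+x. indicator {..<0} x \<partial>M) = 0"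
      unfolding M_def using a by (subst nn_integral_ratio_of_gammas) (auto simp: nn_integral_0_iff_AE indicator_def)
    then have "emeasure M {..<0} = 0" by simp
    then show ?thesis by (intro AE_I[of _ _ "{..<0}"]) auto
  qed
  define C where "C = ennreal (1 / Beta a (1/2)) * (\<integral>\<^sup>+v. ennreal ((v\<^sup>2 + 1) powr (- a - 1/2)) \<partial>lborel)"
  have C: "(\<integral>\<^sup>+x. ennreal ((1 + r\<^sup>2 * x) powr (- (a + 1/2))) \<partial>M) = ennreal ((1 + r) powr (- (2 * a))) * C" if "r > 0" for r :: real
    unfolding M_def C_def using a that by (rule gamma_ratio_half_stieltjes_up_to_constant)
  define s where "s n = 1 / real (Suc n)" for n
  have s: "s \<longlonglongrightarrow> 0" unfolding s_def by (rule LIMSEQ_Suc) (rule lim_1_over_n)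
  have s_pos: "s n > 0" for n by (simp add: s_def)
  have "(\<lambda>n. \<integral>\<^sup>+x. ennreal ((1 + (s n)\<^sup>2 * x) powr (- (a + 1/2))) \<partial>M) \<longlonglongrightarrow> (\<integral>\<^sup>+x. 1 \<partial>M)"
  proof (rule nn_integral_dominated_convergence[where w = "\<lambda>_. 1"])
    show "AE x in M. ennreal ((1 + (s n)\<^sup>2 * x) powr (- (a + 1/2))) \<le> 1" for n
      using M_pos
    proof eventually_elim
      case (elim x)
      then have "(1 + (s n)\<^sup>2 * x) powr (- (a + 1/2)) \<le> (1 + (s n)\<^sup>2 * x) powr 0"
        using a by (intro powr_mono) auto
      also have "\<dots> \<le> 1" by simp
      finally show ?case by (simp add: ennreal_le_1)
    qed
    have "(\<lambda>n. ennreal ((1 + (s n)\<^sup>2 * x) powr (- (a + 1/2)))) \<longlonglongrightarrow> ennreal ((1 + 0\<^sup>2 * x) powr (- (a + 1/2)))" for x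
      by (intro tendsto_intros s) auto
    then show "AE x in M. (\<lambda>n. ennreal ((1 + (s n)\<^sup>2 * x) powr (- (a + 1/2)))) \<longlonglongrightarrow> 1" by simp
  qed (auto simp: M.emeasure_space_1)
  then have "(\<lambda>n. ennreal ((1 + s n) powr (- (2 * a))) * C) \<longlonglongrightarrow> 1"
    unfolding C[OF s_pos] by (simp add: M.emeasure_space_1)
  moreover have "(\<lambda>n. ennreal ((1 + s n) powr (- (2 * a))) * C) \<longlonglongrightarrow> ennreal ((1 + 0) powr (- (2 * a))) * C"
    by (intro tendsto_mult_ennreal tendsto_ennrealI tendsto_intros s) auto
  ultimately have "C = 1" using LIMSEQ_unique by fastforce
  show ?thesis
  proof (cases "r = 0")
    case True
    then show ?thesis by (simp add: M.emeasure_space_1 flip: M_def)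
  next
    case False
    then show ?thesis using C[of r] r \<open>C = 1\<close> by (simp add: M_def)
  qed
qed

section \<open>The Markov-Krein identity for Dirichlet means\<close>

text \<open>
The level sets are cut down to the half line, because the finite-dimensional laws of a Dirichlet
process are prescribed for partitions of the half line.
\<close>
lemma simple_function_level_partition:
  fixes \<phi> :: "real \<Rightarrow> real"
  assumes "simple_function borel \<phi>" "\<And>x. \<phi> x \<ge> 0"
  obtains k :: nat and c :: "nat \<Rightarrow> real" and C :: "nat \<Rightarrow> real set" where
    "\<And>i. i < k \<Longrightarrow> c i \<ge> 0" "\<And>i. i < k \<Longrightarrow> C i \<in> sets borel"
    "disjoint_family_on C {..<k}" "(\<Union>i<k. C i) = {0..}"
    "\<And>i x. i < k \<Longrightarrow> x \<in> C i \<Longrightarrow> \<phi> x = c i"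
proof -
  have "finite (\<phi> ` {0..})"
    using finite_subset[OF image_mono[OF subset_UNIV]] assms(1) by (auto simp: simple_function_def)
  from ex_bij_betw_nat_finite[OF this] obtain c where c: "bij_betw c {0..<card (\<phi> ` {0..})} (\<phi> ` {0..})" by blast
  define k where "k = card (\<phi> ` {0..})"
  have c: "bij_betw c {..<k} (\<phi> ` {0..})" using c by (simp add: k_def atLeast0LessThan)
  define C where "C i = \<phi> -` {c i} \<inter> {0..}" for i
  have [measurable]: "\<phi> \<in> borel_measurable borel"
    by (rule borel_measurable_simple_function[OF assms(1)])
  show ?thesis
  proof (rule that[of k c C])
    show "c i \<ge> 0" if "i < k" for i
    proof -
      have "c i \<in> \<phi> ` {0..}" using bij_betwE[OF c] that by auto
      then show ?thesis using assms(2) by auto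
    qed
    have "\<phi> -` {c i} \<inter> space borel \<in> sets borel" for i by measurable
    then show "C i \<in> sets borel" for i unfolding C_def by auto
    show "disjoint_family_on C {..<k}"
      using c by (auto simp: disjoint_family_on_def C_def bij_betw_def inj_on_def)
    show "(\<Union>i<k. C i) = {0..}"
    proof (intro equalityI subsetI)
      fix x :: real assume "x \<in> {0..}"
      then have "\<phi> x \<in> c ` {..<k}" using c by (auto simp: bij_betw_def)
      then show "x \<in> (\<Union>i<k. C i)" using \<open>x \<in> {0..}\<close> by (auto simp: C_def)
    qed (auto simp: C_def)
    show "\<phi> x = c i" if "x \<in> C i" for i x using that by (simp add: C_def)
  qed
qed

lemma integral_constant_on_partition:
  fixes M :: "'a measure" and \<phi> :: "'a \<Rightarrow> real" and k :: nat
  assumes "finite_measure M" and C: "\<And>i. i < k \<Longrightarrow> C i \<in> sets M" "disjoint_family_on C {..<k}"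
    and cover: "AE x in M. x \<in> (\<Union>i<k. C i)" and \<phi>: "\<phi> \<in> borel_measurable M"
    and const: "\<And>i x. i < k \<Longrightarrow> x \<in> C i \<Longrightarrow> \<phi> x = c i"
  shows "(\<integral>x. \<phi> x \<partial>M) = (\<Sum>i<k. c i * measure M (C i))"
proof -
  interpret finite_measure M by fact
  have "AE x in M. \<phi> x = (\<Sum>i<k. c i * indicator (C i) x)"
    using cover
  proof eventually_elim
    case (elim x)
    then obtain j where j: "j < k" "x \<in> C j" by auto
    have "indicator (C i) x = (if i = j then 1 else 0 :: real)" if "i < k" for i
      using j that C(2) by (auto simp: disjoint_family_on_def indicator_def)
    then have "(\<Sum>i<k. c i * indicator (C i) x) = (\<Sum>i<k. if i = j then c i else 0)"
      by (intro sum.cong) auto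
    then show ?case using j const by simp
  qed
  then have "(\<integral>x. \<phi> x \<partial>M) = (\<integral>x. (\<Sum>i<k. c i * indicator (C i) x) \<partial>M)"
    using C(1) by (intro integral_cong_AE \<phi> borel_measurable_sum borel_measurable_times) auto
  also have "\<dots> = (\<Sum>i<k. c i * measure M (C i))"
    using C(1) by (subst Bochner_Integration.integral_sum) (auto simp: emeasure_eq_measure)
  finally show ?thesis .
qed

lemma dirichlet_processD:
  assumes "dirichlet_process \<Omega> P \<theta> F"
  shows "prob_space \<Omega>" "P \<in> \<Omega> \<rightarrow>\<^sub>M prob_algebra (restrict_space borel {0..})"
    "\<And>\<omega>. \<omega> \<in> space \<Omega> \<Longrightarrow> prob_space (P \<omega>)"
    "\<And>\<omega>. \<omega> \<in> space \<Omega> \<Longrightarrow> sets (P \<omega>) = sets (restrict_space borel {0..})"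
    "\<And>\<omega>. \<omega> \<in> space \<Omega> \<Longrightarrow> space (P \<omega>) = {0..}"
proof -
  show "prob_space \<Omega>" and P: "P \<in> \<Omega> \<rightarrow>\<^sub>M prob_algebra (restrict_space borel {0..})"
    using assms by (auto simp: dirichlet_process_def)
  fix \<omega> assume "\<omega> \<in> space \<Omega>"
  with P have "P \<omega> \<in> space (prob_algebra (restrict_space borel {0..}))"
    by (rule measurable_space)
  then show "prob_space (P \<omega>)" and s: "sets (P \<omega>) = sets (restrict_space borel {0..})"
    by (auto simp: space_prob_algebra)
  show "space (P \<omega>) = {0..}"
    using sets_eq_imp_space_eq[OF s] by (simp add: space_restrict_space)
qed

text \<open>
On the level sets of a simple function the random integral is a linear form in the
Dirichlet vector of their masses. The exponents of the resulting product are the masses that \<open>F\<close> gives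
to the level sets, so the product is the exponential of an integral against \<open>F\<close>.
\<close>
lemma dirichlet_process_stieltjes_simple:
  assumes DP: "dirichlet_process \<Omega> P \<theta> F" and F: "prob_space F" "sets F = sets borel" "AE x in F. 0 \<le> x"
    and \<theta>: "\<theta> > 0" and \<phi>: "simple_function borel \<phi>" "\<And>x. \<phi> x \<ge> 0"
  shows "(\<integral>\<^sup>+\<omega>. ennreal ((1 + (\<integral>x. \<phi> x \<partial>P \<omega>)) powr (- \<theta>)) \<partial>\<Omega>) = ennreal (exp (- \<theta> * (\<integral>x. ln (1 + \<phi> x) \<partial>F)))"
proof -
  note D = dirichlet_processD[OF DP]
  interpret F: prob_space F by fact
  obtain k :: nat and c C where c: "\<And>i. i < k \<Longrightarrow> c i \<ge> 0" and C: "\<And>i. i < k \<Longrightarrow> C i \<in> sets borel"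
    and disj: "disjoint_family_on C {..<k}" and un: "(\<Union>i<k. C i) = {0..}"
    and const: "\<And>i x. i < k \<Longrightarrow> x \<in> C i \<Longrightarrow> \<phi> x = c i"
    using simple_function_level_partition[OF \<phi>] by metis
  have \<phi>m [measurable]: "\<phi> \<in> borel_measurable borel"
    by (rule borel_measurable_simple_function[OF \<phi>(1)])
  define \<alpha> where "\<alpha> i = \<theta> * measure F (C i)" for i
  let ?V = "\<lambda>\<omega>. \<lambda>i\<in>{..<k}. measure (P \<omega>) (C i)"
  have law: "distr \<Omega> (\<Pi>\<^sub>M i\<in>{..<k}. borel) ?V = dirichlet_law k \<alpha>"
    using DP C disj un unfolding dirichlet_process_def \<alpha>_def by blast
  have Cr: "C i \<in> sets (restrict_space borel {0..})" if "i < k" for i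
    using C[OF that] un that by (auto simp: sets_restrict_space_iff)
  have P: "P \<in> \<Omega> \<rightarrow>\<^sub>M subprob_algebra (restrict_space borel {0..})"
    using D(2) by (rule measurable_prob_algebraD)
  have V [measurable]: "?V \<in> \<Omega> \<rightarrow>\<^sub>M (\<Pi>\<^sub>M i\<in>{..<k}. borel)"
  proof (rule measurable_restrict)
    fix i assume "i \<in> {..<k}"
    then have "C i \<in> sets (restrict_space borel {0..})" using Cr by simp
    then show "(\<lambda>\<omega>. measure (P \<omega>) (C i)) \<in> borel_measurable \<Omega>"
      by (rule measurable_compose[OF P measurable_measure_subprob_algebra])
  qed
  have P_int: "(\<integral>x. \<phi> x \<partial>P \<omega>) = (\<Sum>i<k. c i * ?V \<omega> i)" if \<omega>: "\<omega> \<in> space \<Omega>" for \<omega>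
  proof -
    have "(\<integral>x. \<phi> x \<partial>P \<omega>) = (\<Sum>i<k. c i * measure (P \<omega>) (C i))"
    proof (rule integral_constant_on_partition[OF _ _ disj _ _ const])
      show "finite_measure (P \<omega>)" using D(3)[OF \<omega>] by (rule prob_space.finite_measure)
      show "C i \<in> sets (P \<omega>)" if "i < k" for i using Cr[OF that] D(4)[OF \<omega>] by simp
      show "AE x in P \<omega>. x \<in> (\<Union>i<k. C i)" using un D(5)[OF \<omega>] by (intro AE_I2) simp
      show "\<phi> \<in> borel_measurable (P \<omega>)"
        unfolding measurable_cong_sets[OF D(4)[OF \<omega>] refl] by (intro measurable_restrict_space1 \<phi>m)
    qed
    then show ?thesis by simp
  qed
  have F_cover: "AE x in F. x \<in> (\<Union>i<k. C i)" using F(3) un by simp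
  have "(\<Sum>i<k. 1 * measure F (C i)) = (\<integral>x. 1 \<partial>F)"
    by (rule integral_constant_on_partition[symmetric, OF _ _ disj F_cover])
      (use C F(2) F.finite_measure_axioms in auto)
  then have sum_\<alpha>: "(\<Sum>i<k. \<alpha> i) = \<theta>"
    by (simp add: \<alpha>_def sum_distrib_left[symmetric] F.prob_space)
  have F_int: "(\<integral>x. ln (1 + \<phi> x) \<partial>F) = (\<Sum>i<k. ln (1 + c i) * measure F (C i))"
    by (rule integral_constant_on_partition[OF _ _ disj F_cover])
      (use C F(2) F.finite_measure_axioms const in \<open>auto simp: measurable_cong_sets[OF F(2) refl]\<close>)
  have "(\<integral>\<^sup>+\<omega>. ennreal ((1 + (\<integral>x. \<phi> x \<partial>P \<omega>)) powr (- \<theta>)) \<partial>\<Omega>)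
    = (\<integral>\<^sup>+\<omega>. ennreal ((1 + (\<Sum>i<k. c i * ?V \<omega> i)) powr (- (\<Sum>i<k. \<alpha> i))) \<partial>\<Omega>)"
    by (intro nn_integral_cong) (simp only: P_int sum_\<alpha>)
  also have "\<dots> = (\<integral>\<^sup>+p. ennreal ((1 + (\<Sum>i<k. c i * p i)) powr (- (\<Sum>i<k. \<alpha> i))) \<partial>dirichlet_law k \<alpha>)"
    unfolding law[symmetric] by (rule nn_integral_distr[symmetric, OF V]) measurable
  also have "\<dots> = ennreal (\<Prod>i<k. (1 + c i) powr (- \<alpha> i))"
    using c \<theta> by (intro dirichlet_law_stieltjes) (auto simp: \<alpha>_def)
  also have "(\<Prod>i<k. (1 + c i) powr (- \<alpha> i)) = (\<Prod>i<k. exp (- \<theta> * (ln (1 + c i) * measure F (C i))))"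
    using c by (intro prod.cong) (auto simp: powr_def \<alpha>_def add_nonneg_eq_0_iff mult_ac)
  also have "\<dots> = exp (- \<theta> * (\<integral>x. ln (1 + \<phi> x) \<partial>F))"
    unfolding F_int sum_distrib_left by (rule exp_sum[symmetric]) simp
  finally show ?thesis .
qed

text \<open>
Up to an additive constant, \<open>ln (1 + x)\<close> dominates all its scaled versions.
\<close>
lemma ln_one_plus_le_add:
  fixes l x :: real
  assumes "l \<ge> 0" "x \<ge> 0"
  shows "ln (1 + l * x) \<le> ln (1 + l) + ln (1 + x)"
proof -
  have "ln (1 + l * x) \<le> ln ((1 + l) * (1 + x))"
  proof (intro ln_le_cancel_iff[THEN iffD2])
    show "1 + l * x > 0" "(1 + l) * (1 + x) > 0"
      using assms by (auto intro!: add_pos_nonneg mult_pos_pos)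
    show "1 + l * x \<le> (1 + l) * (1 + x)" using assms by (simp add: algebra_simps)
  qed
  also have "\<dots> = ln (1 + l) + ln (1 + x)" using assms by (intro ln_mult_pos) auto
  finally show ?thesis .
qed

lemma integrable_ln_one_plus_scaled:
  fixes F :: "real measure" and l :: real
  assumes F: "prob_space F" "sets F = sets borel" "AE x in F. 0 \<le> x"
    and int: "integrable F (\<lambda>x. ln (1 + x))" and l: "l \<ge> 0"
  shows "integrable F (\<lambda>x. ln (1 + l * x))"
proof -
  interpret prob_space F by fact
  note [measurable_cong] = F(2)
  show ?thesis
  proof (rule Bochner_Integration.integrable_bound)
    show "integrable F (\<lambda>x. ln (1 + l) + ln (1 + x))" using int by simp
    show "AE x in F. norm (ln (1 + l * x)) \<le> norm (ln (1 + l) + ln (1 + x))"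
      using F(3)
    proof eventually_elim
      case (elim x)
      then have "0 \<le> ln (1 + l * x)" "0 \<le> ln (1 + l) + ln (1 + x)" using l by auto
      then show ?case using ln_one_plus_le_add[OF l elim] by simp
    qed
  qed measurable
qed

text \<open>
Simple functions increasing to the identity give this by dominated convergence on both sides.
Finiteness of the mean is not available yet: where the mean \<open>T\<close> is infinite, the integrands tend to
\<open>(1 + \<infinity>)\<^bsup>-\<theta>\<^esup> = 0\<close>.
\<close>
lemma dirichlet_process_stieltjes_extended:
  fixes l :: real
  assumes DP: "dirichlet_process \<Omega> P \<theta> F" and F: "prob_space F" "sets F = sets borel" "AE x in F. 0 \<le> x"
    and \<theta>: "\<theta> > 0" and int: "integrable F (\<lambda>x. ln (1 + x))" and l: "l > 0"
  defines "T \<equiv> \<lambda>\<omega>. \<integral>\<^sup>+x. ennreal x \<partial>P \<omega>"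
  shows "(\<integral>\<^sup>+\<omega>. (if T \<omega> = \<infinity> then 0 else ennreal ((1 + l * enn2real (T \<omega>)) powr (- \<theta>))) \<partial>\<Omega>)
    = ennreal (exp (- \<theta> * (\<integral>x. ln (1 + l * x) \<partial>F)))"
proof -
  note D = dirichlet_processD[OF DP]
  interpret \<Omega>: prob_space \<Omega> by (rule D(1))
  interpret F: prob_space F by fact
  note [measurable_cong] = F(2)
  let ?N = "restrict_space borel {0..} :: real measure"
  have P [measurable]: "P \<in> \<Omega> \<rightarrow>\<^sub>M subprob_algebra ?N"
    using D(2) by (rule measurable_prob_algebraD)
  \<comment> \<open>The approximation by simple functions needs a nonnegative function; on the half line it is the identity.\<close>
  define u where "u x = max 0 x" for x :: real
  have u_meas: "u \<in> borel_measurable borel" unfolding u_def by measurable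
  have u_nonneg: "u x \<ge> 0" for x by (simp add: u_def)
  from borel_measurable_implies_simple_function_sequence_real[OF u_meas u_nonneg]
  obtain f where f: "incseq f" "\<And>i. simple_function borel (f i)" "\<And>x. bdd_above (range (\<lambda>i. f i x))"
    "\<And>i x. 0 \<le> f i x" "u = (SUP i. f i)" by blast
  have fm [measurable]: "f i \<in> borel_measurable borel" for i
    by (rule borel_measurable_simple_function[OF f(2)])
  have inc: "incseq (\<lambda>i. f i x)" for x
    using f(1) by (auto simp: incseq_def le_fun_def)
  have lim: "(\<lambda>i. f i x) \<longlonglongrightarrow> u x" for x
    using LIMSEQ_incseq_SUP[OF f(3) inc, of x] by (simp add: f(5) image_image)
  have f_le: "f i x \<le> u x" for i x
    by (rule incseq_le[OF inc lim])
  define m where "m n \<omega> = (\<integral>x. f n x \<partial>P \<omega>)" for n \<omega>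
  have fP: "f n \<in> borel_measurable (P \<omega>)" if "\<omega> \<in> space \<Omega>" for n \<omega>
    unfolding measurable_cong_sets[OF D(4)[OF that] refl] by (intro measurable_restrict_space1 fm)
  have f_bdd: "\<exists>B. \<forall>x. f n x \<le> B" for n
  proof -
    have "finite (range (f n))" using f(2)[of n] by (simp add: simple_function_def)
    then have "\<forall>x. f n x \<le> Max (range (f n))" by (auto intro: Max_ge)
    then show ?thesis by blast
  qed
  have m_nn: "ennreal (m n \<omega>) = (\<integral>\<^sup>+x. ennreal (f n x) \<partial>P \<omega>)" if \<omega>: "\<omega> \<in> space \<Omega>" for n \<omega>
  proof -
    interpret P: prob_space "P \<omega>" using D(3)[OF \<omega>] .
    obtain B where B: "\<forall>x. f n x \<le> B" using f_bdd by blast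
    have "integrable (P \<omega>) (f n)"
      by (rule P.integrable_const_bound[of _ B]) (use B f(4) fP[OF \<omega>] in auto)
    then show ?thesis
      unfolding m_def by (intro nn_integral_eq_integral[symmetric]) (use f(4) in auto)
  qed
  have m_nonneg: "m n \<omega> \<ge> 0" for n \<omega>
    unfolding m_def using f(4) by (intro integral_nonneg_AE) auto
  have m_lim: "(\<lambda>n. ennreal (m n \<omega>)) \<longlonglongrightarrow> T \<omega>" if \<omega>: "\<omega> \<in> space \<Omega>" for \<omega>
  proof -
    have "(\<lambda>n. \<integral>\<^sup>+x. ennreal (f n x) \<partial>P \<omega>) \<longlonglongrightarrow> (\<integral>\<^sup>+x. ennreal (u x) \<partial>P \<omega>)"
    proof (rule nn_integral_LIMSEQ)
      show "incseq (\<lambda>n x. ennreal (f n x))"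
        using f(1) by (auto simp: incseq_def le_fun_def intro!: ennreal_leI)
      show "(\<lambda>x. ennreal (f n x)) \<in> borel_measurable (P \<omega>)" for n using fP[OF \<omega>] by measurable
      show "(\<lambda>n. ennreal (f n x)) \<longlonglongrightarrow> ennreal (u x)" for x using lim by (rule tendsto_ennrealI)
    qed
    moreover have "(\<integral>\<^sup>+x. ennreal (u x) \<partial>P \<omega>) = T \<omega>"
      unfolding T_def using D(5)[OF \<omega>] by (intro nn_integral_cong) (simp add: u_def)
    ultimately show ?thesis by (simp add: m_nn[OF \<omega>])
  qed
  let ?h = "\<lambda>\<omega>. if T \<omega> = \<infinity> then 0 else ennreal ((1 + l * enn2real (T \<omega>)) powr (- \<theta>))"
  have id_meas: "(\<lambda>x. ennreal x) \<in> borel_measurable ?N"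
    by (intro measurable_restrict_space1) measurable
  have [measurable]: "T \<in> borel_measurable \<Omega>"
    unfolding T_def by (rule measurable_compose[OF P nn_integral_measurable_subprob_algebra[OF id_meas]])
  have "m n \<in> borel_measurable \<Omega>" for n
  proof -
    have "(\<lambda>x. ennreal (f n x)) \<in> borel_measurable ?N"
      by (intro measurable_restrict_space1) measurable
    then have "(\<lambda>\<omega>. enn2real (\<integral>\<^sup>+x. ennreal (f n x) \<partial>P \<omega>)) \<in> borel_measurable \<Omega>"
      by (intro borel_measurable_enn2real measurable_compose[OF P nn_integral_measurable_subprob_algebra])
    moreover have "m n \<omega> = enn2real (\<integral>\<^sup>+x. ennreal (f n x) \<partial>P \<omega>)" if "\<omega> \<in> space \<Omega>" for \<omega>
      using m_nn[OF that] m_nonneg by (metis enn2real_ennreal)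
    ultimately show ?thesis by (simp cong: measurable_cong)
  qed
  note [measurable] = this
  have h_lim: "(\<lambda>n. ennreal ((1 + l * m n \<omega>) powr (- \<theta>))) \<longlonglongrightarrow> ?h \<omega>" if \<omega>: "\<omega> \<in> space \<Omega>" for \<omega>
  proof (cases "T \<omega> = \<infinity>")
    case True
    then have "filterlim (\<lambda>n. m n \<omega>) at_top sequentially"
      using m_lim[OF \<omega>] by (simp add: ennreal_tendsto_top_eq_at_top)
    then have "filterlim (\<lambda>n. 1 + l * m n \<omega>) at_top sequentially"
      by (intro filterlim_tendsto_add_at_top[OF tendsto_const]
          filterlim_tendsto_pos_mult_at_top[OF tendsto_const l])
    then have "(\<lambda>n. (1 + l * m n \<omega>) powr (- \<theta>)) \<longlonglongrightarrow> 0"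
      using \<theta> by (intro tendsto_neg_powr) auto
    then show ?thesis using True tendsto_ennrealI by fastforce
  next
    case False
    define t where "t = enn2real (T \<omega>)"
    have t: "T \<omega> = ennreal t" "t \<ge> 0" using False by (simp_all add: t_def less_top)
    have "(\<lambda>n. m n \<omega>) \<longlonglongrightarrow> t"
      using m_lim[OF \<omega>] t m_nonneg by (intro tendsto_ennrealD) auto
    moreover have "1 + l * t \<noteq> 0" using t l by (simp add: add_nonneg_eq_0_iff)
    ultimately have "(\<lambda>n. ennreal ((1 + l * m n \<omega>) powr (- \<theta>))) \<longlonglongrightarrow> ennreal ((1 + l * t) powr (- \<theta>))"
      by (intro tendsto_ennrealI tendsto_intros) simp_all
    then show ?thesis using t by simp
  qed
  have L1: "(\<lambda>n. \<integral>\<^sup>+\<omega>. ennreal ((1 + l * m n \<omega>) powr (- \<theta>)) \<partial>\<Omega>) \<longlonglongrightarrow> (\<integral>\<^sup>+\<omega>. ?h \<omega> \<partial>\<Omega>)"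
  proof (rule nn_integral_dominated_convergence[where w = "\<lambda>_. 1"])
    show "AE \<omega> in \<Omega>. ennreal ((1 + l * m n \<omega>) powr (- \<theta>)) \<le> 1" for n
    proof (rule AE_I2)
      fix \<omega>
      have "(1 + l * m n \<omega>) powr (- \<theta>) \<le> (1 + l * m n \<omega>) powr 0"
        using \<theta> l m_nonneg by (intro powr_mono) auto
      also have "\<dots> \<le> 1" by simp
      finally show "ennreal ((1 + l * m n \<omega>) powr (- \<theta>)) \<le> 1" by (simp add: ennreal_le_1)
    qed
    show "AE \<omega> in \<Omega>. (\<lambda>n. ennreal ((1 + l * m n \<omega>) powr (- \<theta>))) \<longlonglongrightarrow> ?h \<omega>"
      using h_lim by (rule AE_I2)
  qed (auto simp: \<Omega>.emeasure_space_1)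
  have simple: "(\<integral>\<^sup>+\<omega>. ennreal ((1 + l * m n \<omega>) powr (- \<theta>)) \<partial>\<Omega>) = ennreal (exp (- \<theta> * (\<integral>x. ln (1 + l * f n x) \<partial>F)))" for n
    using dirichlet_process_stieltjes_simple[OF DP F \<theta>, of "\<lambda>x. l * f n x"] f(2,4) l
    by (simp add: m_def simple_function_compose1)
  have L2: "(\<lambda>n. \<integral>x. ln (1 + l * f n x) \<partial>F) \<longlonglongrightarrow> (\<integral>x. ln (1 + l * x) \<partial>F)"
  proof (rule integral_dominated_convergence[where w = "\<lambda>x. ln (1 + l * x)"])
    show "integrable F (\<lambda>x. ln (1 + l * x))"
      by (rule integrable_ln_one_plus_scaled[OF F int]) (use l in simp)
    show "AE x in F. (\<lambda>n. ln (1 + l * f n x)) \<longlonglongrightarrow> ln (1 + l * x)"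
      using F(3)
    proof eventually_elim
      case (elim x)
      have "(\<lambda>n. ln (1 + l * f n x)) \<longlonglongrightarrow> ln (1 + l * u x)"
        using l elim by (intro tendsto_intros lim) (auto simp: u_def add_nonneg_eq_0_iff)
      then show ?case using elim by (simp add: u_def)
    qed
    show "AE x in F. norm (ln (1 + l * f n x)) \<le> ln (1 + l * x)" for n
      using F(3)
    proof eventually_elim
      case (elim x)
      have "f n x \<le> x" using f_le[of n x] elim by (simp add: u_def)
      then have "l * f n x \<le> l * x" using l by simp
      moreover have "0 \<le> l * f n x" using l f(4) by simp
      ultimately show ?case by simp
    qed
  qed measurable
  have "(\<lambda>n. \<integral>\<^sup>+\<omega>. ennreal ((1 + l * m n \<omega>) powr (- \<theta>)) \<partial>\<Omega>) \<longlonglongrightarrow> ennreal (exp (- \<theta> * (\<integral>x. ln (1 + l * x) \<partial>F)))"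
    unfolding simple by (intro tendsto_ennrealI tendsto_intros L2)
  with L1 show ?thesis by (rule LIMSEQ_unique)
qed

text \<open>
As \<open>l\<close> tends to 0, the right-hand side of the extended identity tends to 1, while its left-hand side is at most
the probability that the mean is finite. Hence the mean is finite almost surely, and the extended identity
becomes a statement about the law of the mean.
\<close>
lemma dirichlet_mean_stieltjes:
  assumes DP: "dirichlet_process \<Omega> P \<theta> F" and F: "prob_space F" "sets F = sets borel" "AE x in F. 0 \<le> x"
    and \<theta>: "\<theta> > 0" and int: "integrable F (\<lambda>x. ln (1 + x))"
  shows "dirichlet_mean_finite \<Omega> P"
    and "prob_space (dirichlet_mean_law \<Omega> P)"
    and "sets (dirichlet_mean_law \<Omega> P) = sets borel"
    and "AE y in dirichlet_mean_law \<Omega> P. 0 \<le> y"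
    and "\<And>l. l > 0 \<Longrightarrow> (\<integral>\<^sup>+y. ennreal ((1 + l * y) powr (- \<theta>)) \<partial>dirichlet_mean_law \<Omega> P)
      = ennreal (exp (- \<theta> * (\<integral>x. ln (1 + l * x) \<partial>F)))"
proof -
  note D = dirichlet_processD[OF DP]
  interpret \<Omega>: prob_space \<Omega> by (rule D(1))
  note [measurable_cong] = F(2)
  let ?N = "restrict_space borel {0..} :: real measure"
  have P: "P \<in> \<Omega> \<rightarrow>\<^sub>M subprob_algebra ?N"
    using D(2) by (rule measurable_prob_algebraD)
  define T where "T \<omega> = (\<integral>\<^sup>+x. ennreal x \<partial>P \<omega>)" for \<omega>
  have "(\<lambda>x. ennreal x) \<in> borel_measurable ?N"
    by (intro measurable_restrict_space1) measurable
  then have [measurable]: "T \<in> borel_measurable \<Omega>"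
    unfolding T_def by (intro measurable_compose[OF P nn_integral_measurable_subprob_algebra])
  note ext = dirichlet_process_stieltjes_extended[OF DP F \<theta> int, folded T_def]
  have id: "(\<lambda>x. x) \<in> borel_measurable (P \<omega>)" "AE x in P \<omega>. 0 \<le> x" if "\<omega> \<in> space \<Omega>" for \<omega>
  proof -
    show "(\<lambda>x. x) \<in> borel_measurable (P \<omega>)"
      unfolding measurable_cong_sets[OF D(4)[OF that] refl] by (intro measurable_restrict_space1) simp
    show "AE x in P \<omega>. 0 \<le> x" by (rule AE_I2) (simp add: D(5)[OF that])
  qed
  have mean: "dirichlet_mean P \<omega> = enn2real (T \<omega>)" if "\<omega> \<in> space \<Omega>" for \<omega>
    unfolding dirichlet_mean_def T_def by (intro integral_eq_nn_integral id that)
  have mean_m [measurable]: "dirichlet_mean P \<in> borel_measurable \<Omega>"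
    by (subst measurable_cong[OF mean]) measurable
  define s where "s n = 1 / real (Suc n)" for n
  have s: "s \<longlonglongrightarrow> 0" unfolding s_def by (rule LIMSEQ_Suc) (rule lim_1_over_n)
  have s_pos: "s n > 0" and s_le: "s n \<le> 1" for n by (simp_all add: s_def)
  have "(\<lambda>n. \<integral>x. ln (1 + s n * x) \<partial>F) \<longlonglongrightarrow> (\<integral>x. ln (1 + 0 * x) \<partial>F)"
  proof (rule integral_dominated_convergence[OF _ _ int])
    show "AE x in F. (\<lambda>n. ln (1 + s n * x)) \<longlonglongrightarrow> ln (1 + 0 * x)"
      by (intro AE_I2 tendsto_intros s) simp
    show "AE x in F. norm (ln (1 + s n * x)) \<le> ln (1 + x)" for n
      using F(3)
    proof eventually_elim
      case (elim x)
      have "0 \<le> s n * x" using s_pos[of n] elim by simp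
      moreover have "s n * x \<le> 1 * x" using s_le elim by (intro mult_right_mono)
      ultimately show ?case by simp
    qed
  qed measurable
  then have "(\<lambda>n. ennreal (exp (- \<theta> * (\<integral>x. ln (1 + s n * x) \<partial>F)))) \<longlonglongrightarrow> ennreal (exp (- \<theta> * (\<integral>x. ln (1 + 0 * x) \<partial>F)))"
    by (intro tendsto_ennrealI tendsto_intros)
  then have lim1: "(\<lambda>n. ennreal (exp (- \<theta> * (\<integral>x. ln (1 + s n * x) \<partial>F)))) \<longlonglongrightarrow> 1" by simp
  have bound: "ennreal (exp (- \<theta> * (\<integral>x. ln (1 + s n * x) \<partial>F))) \<le> emeasure \<Omega> {\<omega> \<in> space \<Omega>. T \<omega> \<noteq> \<infinity>}" for n
  proof -
    have "ennreal (exp (- \<theta> * (\<integral>x. ln (1 + s n * x) \<partial>F)))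
      = (\<integral>\<^sup>+\<omega>. (if T \<omega> = \<infinity> then 0 else ennreal ((1 + s n * enn2real (T \<omega>)) powr (- \<theta>))) \<partial>\<Omega>)"
      by (rule ext[symmetric, OF s_pos])
    also have "\<dots> \<le> (\<integral>\<^sup>+\<omega>. indicator {\<omega> \<in> space \<Omega>. T \<omega> \<noteq> \<infinity>} \<omega> \<partial>\<Omega>)"
    proof (rule nn_integral_mono)
      fix \<omega> assume "\<omega> \<in> space \<Omega>"
      have "(1 + s n * enn2real (T \<omega>)) powr (- \<theta>) \<le> (1 + s n * enn2real (T \<omega>)) powr 0"
        using \<theta> s_pos[of n] by (intro powr_mono) auto
      also have "\<dots> \<le> 1" by simp
      finally have "ennreal ((1 + s n * enn2real (T \<omega>)) powr (- \<theta>)) \<le> 1" by (simp add: ennreal_le_1)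
      then show "(if T \<omega> = \<infinity> then 0 else ennreal ((1 + s n * enn2real (T \<omega>)) powr (- \<theta>)))
        \<le> indicator {\<omega> \<in> space \<Omega>. T \<omega> \<noteq> \<infinity>} \<omega>"
        using \<open>\<omega> \<in> space \<Omega>\<close> by (auto simp: indicator_def)
    qed
    finally show ?thesis by simp
  qed
  have "1 \<le> emeasure \<Omega> {\<omega> \<in> space \<Omega>. T \<omega> \<noteq> \<infinity>}"
    by (rule LIMSEQ_le_const2[OF lim1]) (use bound in auto)
  then have "\<Omega>.prob {\<omega> \<in> space \<Omega>. T \<omega> \<noteq> \<infinity>} = 1"
    using \<Omega>.measure_le_1 by (simp add: \<Omega>.emeasure_eq_measure antisym)
  then have fin: "AE \<omega> in \<Omega>. T \<omega> \<noteq> \<infinity>"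
    by (subst (asm) \<Omega>.prob_Collect_eq_1) auto
  show "dirichlet_mean_finite \<Omega> P"
    unfolding dirichlet_mean_finite_def using fin AE_space
  proof eventually_elim
    case (elim \<omega>)
    then show ?case using id[of \<omega>] by (intro integrableI_nonneg) (auto simp: T_def less_top)
  qed
  show "prob_space (dirichlet_mean_law \<Omega> P)"
    unfolding dirichlet_mean_law_def by (rule \<Omega>.prob_space_distr[OF mean_m])
  show "sets (dirichlet_mean_law \<Omega> P) = sets borel"
    by (simp add: dirichlet_mean_law_def)
  show "AE y in dirichlet_mean_law \<Omega> P. 0 \<le> y"
    unfolding dirichlet_mean_law_def by (subst AE_distr_iff) (auto simp: mean)
  fix l :: real assume l: "l > 0"
  have "(\<integral>\<^sup>+y. ennreal ((1 + l * y) powr (- \<theta>)) \<partial>dirichlet_mean_law \<Omega> P)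
    = (\<integral>\<^sup>+\<omega>. ennreal ((1 + l * dirichlet_mean P \<omega>) powr (- \<theta>)) \<partial>\<Omega>)"
    unfolding dirichlet_mean_law_def by (rule nn_integral_distr) measurable
  also have "\<dots> = (\<integral>\<^sup>+\<omega>. (if T \<omega> = \<infinity> then 0 else ennreal ((1 + l * enn2real (T \<omega>)) powr (- \<theta>))) \<partial>\<Omega>)"
  proof (rule nn_integral_cong_AE)
    show "AE \<omega> in \<Omega>. ennreal ((1 + l * dirichlet_mean P \<omega>) powr (- \<theta>))
      = (if T \<omega> = \<infinity> then 0 else ennreal ((1 + l * enn2real (T \<omega>)) powr (- \<theta>)))"
      using fin AE_space by eventually_elim (simp add: mean)
  qed
  finally show "(\<integral>\<^sup>+y. ennreal ((1 + l * y) powr (- \<theta>)) \<partial>dirichlet_mean_law \<Omega> P)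
    = ennreal (exp (- \<theta> * (\<integral>x. ln (1 + l * x) \<partial>F)))"
    using ext[OF l] by simp
qed

section \<open>Uniqueness for generalised Stieltjes transforms\<close>

lemma borel_measure_eqI_nn_integral:
  assumes "sets M = sets borel" "sets N = sets borel"
    and "\<And>f. f \<in> borel_measurable borel \<Longrightarrow> (\<integral>\<^sup>+x. f x \<partial>M) = (\<integral>\<^sup>+x. f x \<partial>N)"
  shows "M = N"
proof (rule measure_eqI)
  fix A assume "A \<in> sets M"
  then have "A \<in> sets borel" using assms(1) by simp
  then show "emeasure M A = emeasure N A"
    using assms(3)[of "indicator A"] assms(1,2) by simp
qed (use assms in simp)

text \<open>
Writing \<open>(1 + l y)\<^bsup>-a\<^esup>\<close> as a gamma integral with rate \<open>1 / l + y\<close> moves \<open>l\<close> into the exponential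
\<open>e\<^bsup>-s/l\<^esup>\<close>. One factor \<open>e\<^bsup>-s\<^esup>\<close> is kept with the density so that it belongs to a finite measure.
\<close>
lemma stieltjes_transform_as_laplace_transform:
  fixes M :: "real measure"
  assumes M: "prob_space M" "sets M = sets borel" "AE y in M. 0 \<le> y" and a: "a > 0" and l: "l > 0"
  shows "(\<integral>\<^sup>+y. ennreal ((1 + l * y) powr (- a)) \<partial>M)
    = ennreal (1 / (Gamma a * l powr a)) *
      (\<integral>\<^sup>+s. ennreal (exp (- (1 / l - 1) * s)) * (ennreal (if 0 < s then s powr (a - 1) * exp (- s) else 0)
        * (\<integral>\<^sup>+y. ennreal (exp (- (s * y))) \<partial>M)) \<partial>lborel)"
proof -
  interpret prob_space M by fact
  note [measurable_cong] = M(2)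
  interpret pair_sigma_finite lborel M ..
  have G: "Gamma a > 0" using a by (rule Gamma_real_pos)
  let ?k = "\<lambda>y s. ennreal (if 0 < s then s powr (a - 1) * exp (- ((1 / l + y) * s)) else 0)"
  have "(\<integral>\<^sup>+y. ennreal ((1 + l * y) powr (- a)) \<partial>M) = (\<integral>\<^sup>+y. ennreal (1 / (Gamma a * l powr a)) * (\<integral>\<^sup>+s. ?k y s \<partial>lborel) \<partial>M)"
  proof (rule nn_integral_cong_AE, use M(3) in eventually_elim)
    case (elim y)
    have pos: "1 / l + y > 0" "1 + l * y > 0" using l elim by (auto intro!: add_pos_nonneg)
    have "(\<integral>\<^sup>+s. ?k y s \<partial>lborel) = ennreal (Gamma a / (1 / l + y) powr a)"
      using a pos by (intro nn_integral_Gamma_scaled)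
    moreover have "(1 + l * y) powr (- a) = 1 / (Gamma a * l powr a) * (Gamma a / (1 / l + y) powr a)"
    proof -
      have "1 + l * y = l * (1 / l + y)" using l by (simp add: field_simps)
      then have "(1 + l * y) powr a = l powr a * (1 / l + y) powr a" using l pos by (simp only: powr_mult)
      then show ?thesis using G by (simp add: powr_minus field_simps)
    qed
    ultimately show ?case
      using G by (simp only: ennreal_mult[symmetric] divide_nonneg_nonneg mult_nonneg_nonneg powr_ge_zero less_imp_le zero_le_one)
  qed
  also have "\<dots> = ennreal (1 / (Gamma a * l powr a)) * (\<integral>\<^sup>+y. \<integral>\<^sup>+s. ?k y s \<partial>lborel \<partial>M)"
    by (rule nn_integral_cmult) measurable
  also have "(\<integral>\<^sup>+y. \<integral>\<^sup>+s. ?k y s \<partial>lborel \<partial>M) = (\<integral>\<^sup>+s. \<integral>\<^sup>+y. ?k y s \<partial>M \<partial>lborel)"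
    by (rule Fubini') measurable
  also have "\<dots> = (\<integral>\<^sup>+s. ennreal (exp (- (1 / l - 1) * s)) * (ennreal (if 0 < s then s powr (a - 1) * exp (- s) else 0)
        * (\<integral>\<^sup>+y. ennreal (exp (- (s * y))) \<partial>M)) \<partial>lborel)"
  proof (rule nn_integral_cong)
    fix s :: real
    have "?k y s = ennreal (exp (- (1 / l - 1) * s) * (if 0 < s then s powr (a - 1) * exp (- s) else 0)) * ennreal (exp (- (s * y)))" for y
    proof -
      have "exp (- ((1 / l + y) * s)) = exp (- (1 / l - 1) * s) * exp (- s) * exp (- (s * y))"
        by (simp add: mult_exp_exp algebra_simps)
      then have "(if 0 < s then s powr (a - 1) * exp (- ((1 / l + y) * s)) else 0)
        = exp (- (1 / l - 1) * s) * (if 0 < s then s powr (a - 1) * exp (- s) else 0) * exp (- (s * y))" by simp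
      then show ?thesis by (simp only: ennreal_mult'' exp_ge_zero)
    qed
    then have "(\<integral>\<^sup>+y. ?k y s \<partial>M) = ennreal (exp (- (1 / l - 1) * s) * (if 0 < s then s powr (a - 1) * exp (- s) else 0)) * (\<integral>\<^sup>+y. ennreal (exp (- (s * y))) \<partial>M)"
      by (simp only:) (rule nn_integral_cmult, measurable)
    also have "ennreal (exp (- (1 / l - 1) * s) * (if 0 < s then s powr (a - 1) * exp (- s) else 0)) = ennreal (exp (- (1 / l - 1) * s)) * ennreal (if 0 < s then s powr (a - 1) * exp (- s) else 0)"
      by (intro ennreal_mult) auto
    finally show "(\<integral>\<^sup>+y. ?k y s \<partial>M) = ennreal (exp (- (1 / l - 1) * s)) * (ennreal (if 0 < s then s powr (a - 1) * exp (- s) else 0)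
        * (\<integral>\<^sup>+y. ennreal (exp (- (s * y))) \<partial>M))" by (simp only: mult.assoc)
  qed
  finally show ?thesis .
qed

lemma continuous_AE_eq_imp_eq:
  fixes f g :: "real \<Rightarrow> real"
  assumes cont: "continuous_on {0<..} f" "continuous_on {0<..} g"
    and ae: "AE s in lborel. 0 < s \<longrightarrow> f s = g s" and s: "s > 0"
  shows "f s = g s"
proof (rule ccontr)
  assume ne: "f s \<noteq> g s"
  have "open {x \<in> {0<..}. f x - g x \<in> - {0}}"
    by (rule continuous_open_preimage[unfolded vimage_def Int_def, simplified]) 
       (auto intro!: continuous_intros cont)
  then have "open {x. 0 < x \<and> f x \<noteq> g x}" by (simp add: conj_commute)
  then obtain e where e: "e > 0" "ball s e \<subseteq> {x. 0 < x \<and> f x \<noteq> g x}"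
    using ne s open_contains_ball by (metis (mono_tags, lifting) mem_Collect_eq)
  have "AE x in lborel. x \<notin> {s - e<..<s + e}"
    using ae
  proof eventually_elim
    case (elim x)
    then show ?case using e(2) by (auto simp: subset_iff dist_real_def)
  qed
  then have "emeasure lborel {s - e<..<s + e} = 0"
    by (subst (asm) AE_iff_measurable[of "{s - e<..<s + e}"]) auto
  then show False using e by simp
qed

text \<open>
Uniqueness for Laplace transforms is used twice: first for the measures with density
\<open>s\<^bsup>a-1\<^esup> e\<^bsup>-s\<^esup> E e\<^bsup>-sY\<^esup>\<close>, which shows that the Laplace transforms of the two laws agree almost everywhere
and hence, by continuity, everywhere, and then for the laws themselves.
\<close>
lemma stieltjes_transform_determines_law:
  fixes M N :: "real measure"
  assumes M: "prob_space M" "sets M = sets borel" "AE y in M. 0 \<le> y"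
    and N: "prob_space N" "sets N = sets borel" "AE y in N. 0 \<le> y" and a: "a > 0"
    and eq: "\<And>l. l > 0 \<Longrightarrow> (\<integral>\<^sup>+y. ennreal ((1 + l * y) powr (- a)) \<partial>M) = (\<integral>\<^sup>+y. ennreal ((1 + l * y) powr (- a)) \<partial>N)"
  shows "M = N"
proof -
  have G: "Gamma a > 0" using a by (rule Gamma_real_pos)
  define w where "w s = (if 0 < s then s powr (a - 1) * exp (- s) else 0)" for s :: real
  have [measurable]: "w \<in> borel_measurable borel" unfolding w_def by measurable
  have w_int: "(\<integral>\<^sup>+s. ennreal (w s) \<partial>lborel) = ennreal (Gamma a)"
    using nn_integral_Gamma_scaled[OF a, of 1] unfolding w_def mult_1 by simp
  define L where "L K s = (\<integral>\<^sup>+y. ennreal (exp (- (s * y))) \<partial>K)" for K :: "real measure" and s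
  define D where "D K = density lborel (\<lambda>s. ennreal (w s) * L K s)" for K
  have props: "L K \<in> borel_measurable borel" "\<And>s. s \<ge> 0 \<Longrightarrow> L K s \<le> 1"
      "\<And>s. s \<ge> 0 \<Longrightarrow> L K s = ennreal (\<integral>y. exp (- (s * y)) \<partial>K)"
      "continuous_on {0<..} (\<lambda>s. \<integral>y. exp (- (s * y)) \<partial>K)"
      "finite_measure (D K)" "AE s in D K. 0 \<le> s"
    if K: "prob_space K" "sets K = sets borel" "AE y in K. 0 \<le> y" for K
  proof -
    interpret prob_space K by fact
    note [measurable_cong] = K(2)
    show Lm [measurable]: "L K \<in> borel_measurable borel"
      unfolding L_def by measurable
    have exp_le: "AE y in K. norm (exp (- (s * y))) \<le> 1" if "s \<ge> 0" for s
      using K(3) by eventually_elim (use that in simp)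
    show L1: "L K s \<le> 1" if "s \<ge> 0" for s
    proof -
      have "L K s \<le> (\<integral>\<^sup>+y. 1 \<partial>K)" unfolding L_def
        by (intro nn_integral_mono_AE) (use exp_le[OF that] in \<open>eventually_elim, simp\<close>)
      then show ?thesis by (simp add: emeasure_space_1)
    qed
    show "L K s = ennreal (\<integral>y. exp (- (s * y)) \<partial>K)" if "s \<ge> 0" for s
      unfolding L_def by (intro nn_integral_eq_integral integrable_const_bound[OF exp_le[OF that]]) auto
    show "continuous_on {0<..} (\<lambda>s. \<integral>y. exp (- (s * y)) \<partial>K)"
    proof (rule continuous_on_sequentiallyI)
      fix u :: "nat \<Rightarrow> real" and s
      assume u: "\<forall>n. u n \<in> {0<..}" "u \<longlonglongrightarrow> s"
      show "(\<lambda>n. \<integral>y. exp (- (u n * y)) \<partial>K) \<longlonglongrightarrow> (\<integral>y. exp (- (s * y)) \<partial>K)"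
      proof (rule integral_dominated_convergence[where w = "\<lambda>_. 1"])
        show "AE y in K. (\<lambda>n. exp (- (u n * y))) \<longlonglongrightarrow> exp (- (s * y))"
          by (intro AE_I2 tendsto_intros u)
        show "AE y in K. norm (exp (- (u n * y))) \<le> 1" for n
          using u(1) by (intro exp_le) (auto intro: less_imp_le)
      qed auto
    qed
    have "emeasure (D K) (space (D K)) = (\<integral>\<^sup>+s. ennreal (w s) * L K s \<partial>lborel)"
      unfolding D_def by (simp add: emeasure_density)
    also have "\<dots> \<le> (\<integral>\<^sup>+s. ennreal (w s) \<partial>lborel)"
    proof (rule nn_integral_mono)
      fix s
      show "ennreal (w s) * L K s \<le> ennreal (w s)"
        using mult_left_mono[OF L1, of s "ennreal (w s)"] by (cases "s > 0") (auto simp: w_def)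
    qed
    finally show "finite_measure (D K)"
      using w_int by (intro finite_measureI) (auto simp: top_unique)
    show "AE s in D K. 0 \<le> s"
      unfolding D_def by (auto simp: AE_density w_def)
  qed
  have lap: "(\<integral>\<^sup>+s. ennreal (exp (- real n * s)) \<partial>D K) = ennreal (Gamma a * (1 / real (Suc n)) powr a) *
      (\<integral>\<^sup>+y. ennreal ((1 + 1 / real (Suc n) * y) powr (- a)) \<partial>K)"
    if K: "prob_space K" "sets K = sets borel" "AE y in K. 0 \<le> y" for K and n :: nat
  proof -
    \<comment> \<open>With this argument the exponential weight \<open>exp (- (1 / l - 1) * s)\<close> is the one for the natural number \<open>n\<close>.\<close>
    define l where "l = 1 / real (Suc n)"
    have l: "l > 0" "1 / l - 1 = real n" by (simp_all add: l_def)
    note [measurable] = props(1)[OF K]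
    have "(\<integral>\<^sup>+s. ennreal (exp (- real n * s)) \<partial>D K) = (\<integral>\<^sup>+s. ennreal (exp (- real n * s)) * (ennreal (w s) * L K s) \<partial>lborel)"
      unfolding D_def by (subst nn_integral_density) (simp_all add: mult.commute)
    moreover have "(\<integral>\<^sup>+y. ennreal ((1 + l * y) powr (- a)) \<partial>K) = ennreal (1 / (Gamma a * l powr a)) *
      (\<integral>\<^sup>+s. ennreal (exp (- real n * s)) * (ennreal (w s) * L K s) \<partial>lborel)"
      using stieltjes_transform_as_laplace_transform[OF K a l(1)] unfolding l(2) w_def L_def .
    moreover have "ennreal (Gamma a * l powr a) * ennreal (1 / (Gamma a * l powr a)) = 1"
      using G l(1) by (subst ennreal_mult[symmetric]) auto
    ultimately show ?thesis unfolding l_def[symmetric] by (simp add: mult.assoc[symmetric])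
  qed
  have "D M = D N"
  proof (rule laplace_transform_determines_measure)
    show "(\<integral>\<^sup>+s. ennreal (exp (- real n * s)) \<partial>D M) = (\<integral>\<^sup>+s. ennreal (exp (- real n * s)) \<partial>D N)" for n
      unfolding lap[OF M] lap[OF N] by (subst eq) auto
    show "finite_measure (D M)" "finite_measure (D N)"
      by (rule props(5)[OF M], rule props(5)[OF N])
    show "AE s in D M. 0 \<le> s" "AE s in D N. 0 \<le> s"
      by (rule props(6)[OF M], rule props(6)[OF N])
  qed (simp_all add: D_def)
  then have "AE s in lborel. ennreal (w s) * L M s = ennreal (w s) * L N s"
    using props(1)[OF M] props(1)[OF N] unfolding D_def
    by (intro sigma_finite_measure.density_unique[OF sigma_finite_lborel]) auto
  then have ae: "AE s in lborel. 0 < s \<longrightarrow> (\<integral>y. exp (- (s * y)) \<partial>M) = (\<integral>y. exp (- (s * y)) \<partial>N)"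
  proof eventually_elim
    case (elim s)
    show ?case
    proof
      assume s: "0 < s"
      then have "w s > 0" by (simp add: w_def)
      with elim have "L M s = L N s" by (simp add: ennreal_mult_cancel_left)
      then show "(\<integral>y. exp (- (s * y)) \<partial>M) = (\<integral>y. exp (- (s * y)) \<partial>N)"
        using s props(3)[OF M, of s] props(3)[OF N, of s] by (simp add: integral_nonneg_AE)
    qed
  qed
  have L_eq: "L M s = L N s" if "s > 0" for s
    using continuous_AE_eq_imp_eq[OF props(4)[OF M] props(4)[OF N] ae that]
      props(3)[OF M, of s] props(3)[OF N, of s] that by simp
  show ?thesis
  proof (rule laplace_transform_determines_measure)
    fix n :: nat
    show "(\<integral>\<^sup>+x. ennreal (exp (- real n * x)) \<partial>M) = (\<integral>\<^sup>+x. ennreal (exp (- real n * x)) \<partial>N)"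
    proof (cases "n = 0")
      case True
      then show ?thesis using M(1) N(1) by (simp add: prob_space.emeasure_space_1)
    next
      case False
      then show ?thesis using L_eq[of "real n"] by (simp add: L_def)
    qed
  qed (use M N in \<open>auto intro: prob_space.finite_measure\<close>)
qed

section \<open>Beta-gamma algebra\<close>

lemma sets_beta_law [simp, measurable_cong]: "sets (beta_law a b) = sets borel"
  by (simp add: beta_law_def)

lemma prob_space_beta_law:
  assumes "a > 0" "b > 0"
  shows "prob_space (beta_law a b)"
proof -
  let ?f = "\<lambda>t. t powr (a - 1) * (1 - t) powr (b - 1)"
  have B: "Beta a b > 0" using assms by (simp add: Beta_def Gamma_real_pos)
  have total: "(\<integral>\<^sup>+t. ennreal (indicator {0..1} t * ?f t) \<partial>lborel) = ennreal (Beta a b)"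
    using assms by (intro nn_integral_has_integral_lebesgue has_integral_Beta_real) auto
  have "(\<integral>\<^sup>+x. 1 \<partial>beta_law a b)
    = (\<integral>\<^sup>+x. ennreal (1 / Beta a b) * ennreal (indicator {0..1} x * ?f x) \<partial>lborel)"
    unfolding beta_law_def using B
    by (subst nn_integral_density)
      (auto intro!: nn_integral_cong simp: ennreal_mult[symmetric] indicator_def)
  also have "\<dots> = ennreal (1 / Beta a b) * ennreal (Beta a b)"
    by (subst nn_integral_cmult) (simp_all add: total)
  also have "\<dots> = 1" using B by (simp add: ennreal_mult[symmetric])
  finally show ?thesis by (intro prob_spaceI) (simp add: beta_law_def)
qed

text \<open>
With \<open>u = x y\<close> and \<open>y = u + v\<close>, the joint density of the beta variable \<open>x\<close> and the gamma variable
\<open>y\<close> factorises into the gamma densities of \<open>u\<close> and \<open>v\<close>; integrating out \<open>v\<close> leaves that of \<open>u\<close>.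
\<close>
lemma beta_gamma_product:
  assumes a: "a > 0" and b: "b > 0"
  shows "mult_law (beta_law a b) (gamma_law (a + b)) = gamma_law a"
proof (rule borel_measure_eqI_nn_integral)
  fix f :: "real \<Rightarrow> ennreal" assume [measurable]: "f \<in> borel_measurable borel"
  define g where "g p x = (if 0 < x then x powr (p - 1) * exp (- x) / Gamma p else 0)" for p x :: real
  define h where "h x = (if 0 < x \<and> x < 1 then x powr (a - 1) * (1 - x) powr (b - 1) / Beta a b else 0)" for x :: real
  have [measurable]: "g p \<in> borel_measurable borel" "h \<in> borel_measurable borel" for p
    unfolding g_def h_def by measurable
  have G: "Gamma a > 0" "Gamma b > 0" "Gamma (a + b) > 0"
    using a b by (auto intro: Gamma_real_pos)
  have B: "Beta a b > 0" using G by (simp add: Beta_def)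
  have g_nonneg: "g p x \<ge> 0" if "p > 0" for p x
    using Gamma_real_pos[OF that] by (simp add: g_def)
  have h_nonneg: "h x \<ge> 0" for x using B by (simp add: h_def)
  have g_int: "(\<integral>\<^sup>+x. F x \<partial>gamma_law p) = (\<integral>\<^sup>+x. ennreal (g p x) * F x \<partial>lborel)"
    if "p > 0" "F \<in> borel_measurable borel" for p F
    unfolding g_def using that by (rule nn_integral_gamma_law)
  interpret bp: prob_space "beta_law a b" using a b by (rule prob_space_beta_law)
  have kernel: "g (a + b) (u + v) * (1 / (u + v) * h (u / (u + v))) = g a u * g b v" for u v
  proof (cases "u > 0 \<and> v > 0")
    case True
    define y where "y = u + v"
    have y: "y > 0" using True by (simp add: y_def)
    have "1 - u / y = v / y" using y by (simp add: y_def field_simps)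
    moreover have "0 < u / y" "u / y < 1" using True by (auto simp: y_def)
    ultimately have "g (a + b) y * (1 / y * h (u / y))
      = y powr (a + b - 1) * exp (- y) / Gamma (a + b) * (1 / y * ((u / y) powr (a - 1) * (v / y) powr (b - 1) / Beta a b))"
      using y by (simp add: g_def h_def)
    also have "(u / y) powr (a - 1) = u powr (a - 1) / y powr (a - 1)"
      using True y by (simp add: powr_divide)
    also have "(v / y) powr (b - 1) = v powr (b - 1) / y powr (b - 1)"
      using True y by (simp add: powr_divide)
    also have "y powr (a + b - 1) = y * y powr (a - 1) * y powr (b - 1)"
    proof -
      have "y powr (1 + (a - 1) + (b - 1)) = y powr 1 * y powr (a - 1) * y powr (b - 1)"
        by (simp only: powr_add)
      then show ?thesis using y by (simp add: algebra_simps)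
    qed
    also have "exp (- y) = exp (- u) * exp (- v)" by (simp add: y_def mult_exp_exp)
    also have "Beta a b = Gamma a * Gamma b / Gamma (a + b)" by (simp add: Beta_def)
    finally show ?thesis using True y G by (simp add: g_def y_def[symmetric] field_simps)
  next
    case False
    have "g (a + b) (u + v) * (1 / (u + v) * h (u / (u + v))) = 0"
    proof (cases "u + v > 0")
      case True
      then have "\<not> (0 < u / (u + v) \<and> u / (u + v) < 1)"
        using False by (auto simp: zero_less_divide_iff)
      then show ?thesis by (auto simp: h_def)
    qed (simp add: g_def)
    then show ?thesis using False by (auto simp: g_def)
  qed
  have "(\<integral>\<^sup>+z. f z \<partial>mult_law (beta_law a b) (gamma_law (a + b)))
    = (\<integral>\<^sup>+x. \<integral>\<^sup>+y. f (x * y) \<partial>gamma_law (a + b) \<partial>beta_law a b)"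
    by (rule nn_integral_mult_law) (simp_all add: bp.prob_space_axioms)
  also have "\<dots> = (\<integral>\<^sup>+x. \<integral>\<^sup>+y. ennreal (g (a + b) y) * f (x * y) \<partial>lborel \<partial>beta_law a b)"
    using a b by (intro nn_integral_cong g_int) auto
  also have "\<dots> = (\<integral>\<^sup>+x. ennreal (h x) * (\<integral>\<^sup>+y. ennreal (g (a + b) y) * f (x * y) \<partial>lborel) \<partial>lborel)"
    unfolding beta_law_def h_def by (subst nn_integral_density) auto
  also have "\<dots> = (\<integral>\<^sup>+x. \<integral>\<^sup>+y. ennreal (h x) * (ennreal (g (a + b) y) * f (x * y)) \<partial>lborel \<partial>lborel)"
    by (intro nn_integral_cong nn_integral_cmult[symmetric]) measurable
  also have "\<dots> = (\<integral>\<^sup>+y. \<integral>\<^sup>+x. ennreal (h x) * (ennreal (g (a + b) y) * f (x * y)) \<partial>lborel \<partial>lborel)"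
    by (rule lborel_pair.Fubini') measurable
  also have "\<dots> = (\<integral>\<^sup>+y. \<integral>\<^sup>+u. ennreal (g (a + b) y * (1 / y * h (u / y))) * f u \<partial>lborel \<partial>lborel)"
  proof (rule nn_integral_cong)
    fix y :: real
    show "(\<integral>\<^sup>+x. ennreal (h x) * (ennreal (g (a + b) y) * f (x * y)) \<partial>lborel)
      = (\<integral>\<^sup>+u. ennreal (g (a + b) y * (1 / y * h (u / y))) * f u \<partial>lborel)"
    proof (cases "y > 0")
      case True
      have "(\<integral>\<^sup>+x. ennreal (h x) * (ennreal (g (a + b) y) * f (x * y)) \<partial>lborel)
        = ennreal \<bar>1 / y\<bar> * (\<integral>\<^sup>+u. ennreal (h (0 + 1 / y * u)) * (ennreal (g (a + b) y) * f ((0 + 1 / y * u) * y)) \<partial>lborel)"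
        using True by (intro nn_integral_real_affine) auto
      also have "\<dots> = ennreal (1 / y) * (\<integral>\<^sup>+u. ennreal (h (u / y)) * (ennreal (g (a + b) y) * f u) \<partial>lborel)"
        using True by simp
      also have "\<dots> = (\<integral>\<^sup>+u. ennreal (1 / y) * (ennreal (h (u / y)) * (ennreal (g (a + b) y) * f u)) \<partial>lborel)"
        by (rule nn_integral_cmult[symmetric]) measurable
      also have "\<dots> = (\<integral>\<^sup>+u. ennreal (g (a + b) y * (1 / y * h (u / y))) * f u \<partial>lborel)"
      proof (rule nn_integral_cong)
        fix u
        have "ennreal (g (a + b) y * (1 / y * h (u / y))) = ennreal (g (a + b) y) * (ennreal (1 / y) * ennreal (h (u / y)))"
          using True g_nonneg[of "a + b" y] h_nonneg a b
          by (simp only: ennreal_mult[symmetric] divide_nonneg_nonneg mult_nonneg_nonneg less_imp_le zero_le_one add_pos_pos)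
        then show "ennreal (1 / y) * (ennreal (h (u / y)) * (ennreal (g (a + b) y) * f u)) = ennreal (g (a + b) y * (1 / y * h (u / y))) * f u"
          by (simp only: mult_ac)
      qed
      finally show ?thesis .
    qed (simp add: g_def)
  qed
  also have "\<dots> = (\<integral>\<^sup>+u. \<integral>\<^sup>+y. ennreal (g (a + b) y * (1 / y * h (u / y))) * f u \<partial>lborel \<partial>lborel)"
    by (rule lborel_pair.Fubini') measurable
  also have "\<dots> = (\<integral>\<^sup>+u. ennreal (g a u) * f u \<partial>lborel)"
  proof (rule nn_integral_cong)
    fix u :: real
    have "(\<integral>\<^sup>+y. ennreal (g (a + b) y * (1 / y * h (u / y))) * f u \<partial>lborel)
      = ennreal \<bar>1\<bar> * (\<integral>\<^sup>+v. ennreal (g (a + b) (u + 1 * v) * (1 / (u + 1 * v) * h (u / (u + 1 * v)))) * f u \<partial>lborel)"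
      by (rule nn_integral_real_affine) auto
    also have "\<dots> = (\<integral>\<^sup>+v. ennreal (g a u) * f u * ennreal (g b v) \<partial>lborel)"
      unfolding mult_1 kernel using g_nonneg a b by (simp add: ennreal_mult mult_ac)
    also have "\<dots> = ennreal (g a u) * f u * (\<integral>\<^sup>+v. ennreal (g b v) \<partial>lborel)"
      by (rule nn_integral_cmult) measurable
    also have "(\<integral>\<^sup>+v. ennreal (g b v) \<partial>lborel) = 1"
      using g_int[OF b, of "\<lambda>_. 1"] prob_space.emeasure_space_1[OF prob_space_gamma_law, of b] by simp
    finally show "(\<integral>\<^sup>+y. ennreal (g (a + b) y * (1 / y * h (u / y))) * f u \<partial>lborel) = ennreal (g a u) * f u" by simp
  qed
  also have "\<dots> = (\<integral>\<^sup>+u. f u \<partial>gamma_law a)"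
    by (rule g_int[symmetric, OF a]) simp
  finally show "(\<integral>\<^sup>+z. f z \<partial>mult_law (beta_law a b) (gamma_law (a + b))) = (\<integral>\<^sup>+u. f u \<partial>gamma_law a)" .
qed simp_all

lemma ratio_law_mult_law:
  assumes p: "prob_space \<mu>" "prob_space \<nu>" "prob_space \<kappa>"
    and s [measurable_cong]: "sets \<mu> = sets borel" "sets \<nu> = sets borel" "sets \<kappa> = sets borel"
  shows "ratio_law (mult_law \<mu> \<nu>) \<kappa> = mult_law \<mu> (ratio_law \<nu> \<kappa>)"
proof (rule borel_measure_eqI_nn_integral)
  fix f :: "real \<Rightarrow> ennreal" assume [measurable]: "f \<in> borel_measurable borel"
  interpret N: prob_space \<nu> by fact
  interpret M: prob_space \<mu> by fact
  interpret K: prob_space \<kappa> by fact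
  interpret pair_sigma_finite \<mu> \<kappa> ..
  note pm = prob_space_mult_law[OF p(1,2) s(1,2)] and pr = prob_space_ratio_law[OF p(2,3) s(2,3)]
  have [measurable]: "(\<lambda>(x, z). \<integral>\<^sup>+y. f (x * (y / z)) \<partial>\<nu>) \<in> borel_measurable (\<mu> \<Otimes>\<^sub>M \<kappa>)"
    by measurable
  have "(\<integral>\<^sup>+w. f w \<partial>ratio_law (mult_law \<mu> \<nu>) \<kappa>) = (\<integral>\<^sup>+z. \<integral>\<^sup>+w. f (w / z) \<partial>mult_law \<mu> \<nu> \<partial>\<kappa>)"
    by (rule nn_integral_ratio_law) (use pm p s in auto)
  also have "\<dots> = (\<integral>\<^sup>+z. \<integral>\<^sup>+x. \<integral>\<^sup>+y. f (x * (y / z)) \<partial>\<nu> \<partial>\<mu> \<partial>\<kappa>)"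
    by (intro nn_integral_cong, subst nn_integral_mult_law) (use p s in auto)
  also have "\<dots> = (\<integral>\<^sup>+x. \<integral>\<^sup>+z. \<integral>\<^sup>+y. f (x * (y / z)) \<partial>\<nu> \<partial>\<kappa> \<partial>\<mu>)"
    by (rule Fubini') measurable
  also have "\<dots> = (\<integral>\<^sup>+x. \<integral>\<^sup>+w. f (x * w) \<partial>ratio_law \<nu> \<kappa> \<partial>\<mu>)"
    by (intro nn_integral_cong, subst nn_integral_ratio_law) (use p s in auto)
  also have "\<dots> = (\<integral>\<^sup>+w. f w \<partial>mult_law \<mu> (ratio_law \<nu> \<kappa>))"
    by (rule nn_integral_mult_law[symmetric]) (use pr p s in auto)
  finally show "(\<integral>\<^sup>+w. f w \<partial>ratio_law (mult_law \<mu> \<nu>) \<kappa>) = (\<integral>\<^sup>+w. f w \<partial>mult_law \<mu> (ratio_law \<nu> \<kappa>))" .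
qed simp_all

lemma mult_law_commute:
  assumes p: "prob_space \<mu>" "prob_space \<nu>"
    and s [measurable_cong]: "sets \<mu> = sets borel" "sets \<nu> = sets borel"
  shows "mult_law \<mu> \<nu> = mult_law \<nu> \<mu>"
proof (rule borel_measure_eqI_nn_integral)
  fix f :: "real \<Rightarrow> ennreal" assume [measurable]: "f \<in> borel_measurable borel"
  interpret N: prob_space \<nu> by fact
  interpret M: prob_space \<mu> by fact
  interpret pair_sigma_finite \<mu> \<nu> ..
  have "(\<integral>\<^sup>+w. f w \<partial>mult_law \<mu> \<nu>) = (\<integral>\<^sup>+x. \<integral>\<^sup>+y. f (x * y) \<partial>\<nu> \<partial>\<mu>)"
    by (rule nn_integral_mult_law) (use p s in auto)
  also have "\<dots> = (\<integral>\<^sup>+y. \<integral>\<^sup>+x. f (y * x) \<partial>\<mu> \<partial>\<nu>)"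
    by (subst Fubini') (simp_all add: mult.commute)
  also have "\<dots> = (\<integral>\<^sup>+w. f w \<partial>mult_law \<nu> \<mu>)"
    by (rule nn_integral_mult_law[symmetric]) (use p s in auto)
  finally show "(\<integral>\<^sup>+w. f w \<partial>mult_law \<mu> \<nu>) = (\<integral>\<^sup>+w. f w \<partial>mult_law \<nu> \<mu>)" .
qed simp_all

text \<open>
Given the value \<open>y\<close> of the second factor, this is the Laplace transform of a gamma variable at \<open>t y\<close>.
Thus equality of Stieltjes transforms of different orders can be read as equality of gamma mixtures.
\<close>
lemma laplace_transform_gamma_mixture:
  assumes K: "prob_space K" "sets K = sets borel" "AE y in K. 0 \<le> y" and a: "a > 0" and t: "t \<ge> 0"
  shows "(\<integral>\<^sup>+z. ennreal (exp (- (t * z))) \<partial>mult_law (gamma_law a) K) = (\<integral>\<^sup>+y. ennreal ((1 + t * y) powr (- a)) \<partial>K)"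
proof -
  interpret K: prob_space K by fact
  interpret G: prob_space "gamma_law a" by simp
  note [measurable_cong] = K(2)
  have "(\<integral>\<^sup>+z. ennreal (exp (- (t * z))) \<partial>mult_law (gamma_law a) K) = (\<integral>\<^sup>+z. ennreal (exp (- (t * z))) \<partial>mult_law K (gamma_law a))"
    using K(1,2) by (subst mult_law_commute) simp_all
  also have "\<dots> = (\<integral>\<^sup>+y. \<integral>\<^sup>+x. ennreal (exp (- (t * (y * x)))) \<partial>gamma_law a \<partial>K)"
    by (rule nn_integral_mult_law) (use K(1,2) in auto)
  also have "\<dots> = (\<integral>\<^sup>+y. ennreal ((1 + t * y) powr (- a)) \<partial>K)"
  proof (rule nn_integral_cong_AE, use K(3) in eventually_elim)
    case (elim y)
    then show ?case
      using gamma_law_laplace[of a "t * y"] a t by (simp add: mult.assoc)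
  qed
  finally show ?thesis .
qed

lemma AE_mult_law_nonneg:
  assumes p: "prob_space \<mu>" "prob_space \<nu>"
    and s [measurable_cong]: "sets \<mu> = sets borel" "sets \<nu> = sets borel"
    and nn: "AE x in \<mu>. 0 \<le> x" "AE x in \<nu>. 0 \<le> x"
  shows "AE x in mult_law \<mu> \<nu>. 0 \<le> x"
proof -
  have "(\<integral>\<^sup>+z. indicator {..<0} z \<partial>mult_law \<mu> \<nu>) = (\<integral>\<^sup>+x. \<integral>\<^sup>+y. indicator {..<0} (x * y) \<partial>\<nu> \<partial>\<mu>)"
    by (rule nn_integral_mult_law) (use p s in auto)
  also have "\<dots> = (\<integral>\<^sup>+x. 0 \<partial>\<mu>)"
  proof (rule nn_integral_cong_AE, use nn(1) in eventually_elim)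
    case (elim x)
    have "(\<integral>\<^sup>+y. indicator {..<0} (x * y) \<partial>\<nu>) = (\<integral>\<^sup>+y. 0 \<partial>\<nu>)"
    proof (rule nn_integral_cong_AE, use nn(2) in eventually_elim)
      case (elim y)
      then have "0 \<le> x * y" using \<open>0 \<le> x\<close> by simp
      then show ?case by simp
    qed
    then show ?case by simp
  qed
  finally have "emeasure (mult_law \<mu> \<nu>) {..<0} = 0" by simp
  then show ?thesis by (intro AE_I[of _ _ "{..<0}"]) auto
qed

lemma AE_ratio_law_nonneg:
  assumes p: "prob_space \<mu>" "prob_space \<nu>"
    and s [measurable_cong]: "sets \<mu> = sets borel" "sets \<nu> = sets borel"
    and nn: "AE x in \<mu>. 0 \<le> x" "AE x in \<nu>. 0 \<le> x"
  shows "AE x in ratio_law \<mu> \<nu>. 0 \<le> x"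
proof -
  have "(\<integral>\<^sup>+z. indicator {..<0} z \<partial>ratio_law \<mu> \<nu>) = (\<integral>\<^sup>+y. \<integral>\<^sup>+x. indicator {..<0} (x / y) \<partial>\<mu> \<partial>\<nu>)"
    by (rule nn_integral_ratio_law) (use p s in auto)
  also have "\<dots> = (\<integral>\<^sup>+y. 0 \<partial>\<nu>)"
  proof (rule nn_integral_cong_AE, use nn(2) in eventually_elim)
    case (elim y)
    have "(\<integral>\<^sup>+x. indicator {..<0} (x / y) \<partial>\<mu>) = (\<integral>\<^sup>+x. 0 \<partial>\<mu>)"
    proof (rule nn_integral_cong_AE, use nn(1) in eventually_elim)
      case (elim x)
      then have "0 \<le> x / y" using \<open>0 \<le> y\<close> by simp
      then show ?case by (simp add: not_less)
    qed
    then show ?case by simp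
  qed
  finally have "emeasure (ratio_law \<mu> \<nu>) {..<0} = 0" by simp
  then show ?thesis by (intro AE_I[of _ _ "{..<0}"]) auto
qed

section \<open>Dirichlet means with explicit transforms\<close>

lemma prob_space_X_half_law: "prob_space X_half_law"
  unfolding X_half_law_def by (rule prob_space_ratio_law) simp_all

lemma sets_X_half_law [simp, measurable_cong]: "sets X_half_law = sets borel"
  by (simp add: X_half_law_def)

lemma AE_X_half_law_nonneg: "AE x in X_half_law. 0 \<le> x"
  unfolding X_half_law_def by (rule AE_ratio_law_nonneg) (simp_all add: AE_gamma_law_nonneg)

lemma prob_space_bernoulli_law: "prob_space (bernoulli_law p)"
  unfolding bernoulli_law_def by (rule prob_space.prob_space_distr) (simp_all add: prob_space_measure_pmf)

lemma sets_bernoulli_law [simp, measurable_cong]: "sets (bernoulli_law p) = sets borel"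
  by (simp add: bernoulli_law_def)

lemma AE_bernoulli_law_nonneg: "AE x in bernoulli_law p. 0 \<le> x"
  unfolding bernoulli_law_def by (subst AE_distr_iff) simp_all

lemma prob_space_XY_law: "prob_space (XY_law p)"
  unfolding XY_law_def
  by (rule prob_space_mult_law) (simp_all add: prob_space_X_half_law prob_space_bernoulli_law)

lemma sets_XY_law [simp, measurable_cong]: "sets (XY_law p) = sets borel"
  by (simp add: XY_law_def)

lemma AE_XY_law_nonneg: "AE x in XY_law p. 0 \<le> x"
  unfolding XY_law_def
  by (rule AE_mult_law_nonneg)
    (simp_all add: prob_space_X_half_law prob_space_bernoulli_law AE_X_half_law_nonneg AE_bernoulli_law_nonneg)

text \<open>
The logarithm vanishes where the Bernoulli factor is 0, so only the success probability remains.
\<close>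
lemma XY_law_log_moment:
  fixes r p :: real
  assumes r: "r \<ge> 0" and p: "0 \<le> p" "p \<le> 1"
  shows "(\<integral>\<^sup>+x. ennreal (ln (1 + r\<^sup>2 * x)) \<partial>XY_law p) = ennreal (p * (2 * ln (1 + r)))"
proof -
  have "(\<integral>\<^sup>+x. ennreal (ln (1 + r\<^sup>2 * x)) \<partial>XY_law p)
    = (\<integral>\<^sup>+x. \<integral>\<^sup>+y. ennreal (ln (1 + r\<^sup>2 * (x * y))) \<partial>bernoulli_law p \<partial>X_half_law)"
    unfolding XY_law_def
    by (rule nn_integral_mult_law) (simp_all add: prob_space_X_half_law prob_space_bernoulli_law)
  also have "\<dots> = (\<integral>\<^sup>+x. ennreal p * ennreal (ln (1 + r\<^sup>2 * x)) \<partial>X_half_law)"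
    unfolding bernoulli_law_def using p
    by (intro nn_integral_cong, subst nn_integral_distr) (simp_all add: mult.commute)
  also have "\<dots> = ennreal p * ennreal (2 * ln (1 + r))"
    by (subst nn_integral_cmult) (simp_all add: X_half_law_log_moment[OF r])
  also have "\<dots> = ennreal (p * (2 * ln (1 + r)))"
    using p by (simp add: ennreal_mult')
  finally show ?thesis .
qed

text \<open>
The transform depends on the mass \<open>\<theta>\<close> and the weight \<open>q\<close> only through their product. This is why the two
parametrisations of the generalised gamma convolution in the proposition coincide.
\<close>
lemma dirichlet_mean_of_log_moment:
  assumes DP: "dirichlet_process \<Omega> P \<theta> F" and F: "prob_space F" "sets F = sets borel" "AE x in F. 0 \<le> x"
    and \<theta>: "\<theta> > 0" and q: "q \<ge> 0"
    and log: "\<forall>r\<ge>0. (\<integral>\<^sup>+x. ennreal (ln (1 + r\<^sup>2 * x)) \<partial>F) = ennreal (q * (2 * ln (1 + r)))"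
  shows "dirichlet_mean_finite \<Omega> P"
    and "prob_space (dirichlet_mean_law \<Omega> P)" "sets (dirichlet_mean_law \<Omega> P) = sets borel"
    and "AE y in dirichlet_mean_law \<Omega> P. 0 \<le> y"
    and "l > 0 \<Longrightarrow> (\<integral>\<^sup>+y. ennreal ((1 + l * y) powr (- \<theta>)) \<partial>dirichlet_mean_law \<Omega> P)
      = ennreal ((1 + sqrt l) powr (- (2 * (\<theta> * q))))"
proof -
  note [measurable_cong] = F(2)
  have nonneg: "AE x in F. 0 \<le> ln (1 + r\<^sup>2 * x)" for r :: real
    using F(3) by eventually_elim simp
  have "(\<integral>\<^sup>+x. ennreal (ln (1 + x)) \<partial>F) < \<infinity>"
    using log[rule_format, of 1] by simp
  then have int: "integrable F (\<lambda>x. ln (1 + x))"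
    using nonneg[of 1] by (intro integrableI_nonneg) simp_all
  note S = dirichlet_mean_stieltjes[OF DP F \<theta> int]
  show "dirichlet_mean_finite \<Omega> P" "prob_space (dirichlet_mean_law \<Omega> P)"
    "sets (dirichlet_mean_law \<Omega> P) = sets borel" "AE y in dirichlet_mean_law \<Omega> P. 0 \<le> y"
    by (rule S)+
  assume l: "l > 0"
  have "(\<integral>x. ln (1 + l * x) \<partial>F) = (\<integral>x. ln (1 + (sqrt l)\<^sup>2 * x) \<partial>F)" using l by simp
  also have "\<dots> = enn2real (\<integral>\<^sup>+x. ennreal (ln (1 + (sqrt l)\<^sup>2 * x)) \<partial>F)"
    by (rule integral_eq_nn_integral[OF _ nonneg]) measurable
  also have "\<dots> = q * (2 * ln (1 + sqrt l))"
    using l q by (subst log[rule_format]) simp_all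
  finally have "exp (- \<theta> * (\<integral>x. ln (1 + l * x) \<partial>F)) = (1 + sqrt l) powr (- (2 * (\<theta> * q)))"
    using l by (simp add: powr_def mult_ac add_nonneg_eq_0_iff)
  then show "(\<integral>\<^sup>+y. ennreal ((1 + l * y) powr (- \<theta>)) \<partial>dirichlet_mean_law \<Omega> P)
      = ennreal ((1 + sqrt l) powr (- (2 * (\<theta> * q))))"
    by (simp only: S(5)[OF l])
qed

theorem proposition4p3:
  fixes \<theta> :: real
  assumes "\<theta> > - 1/2"
  shows
    "X_half_param_law \<theta> =
       mult_law (beta_law (\<theta> + 1/2) (1/2)) (X_half_param_law (\<theta> + 1/2)) \<and>
     (\<forall>(\<Omega> :: 'a measure) P.
        dirichlet_process \<Omega> P (1 + \<theta>) (XY_law ((\<theta> + 1/2) / (1 + \<theta>))) \<longrightarrow>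
        dirichlet_mean_finite \<Omega> P \<and> X_half_param_law \<theta> = dirichlet_mean_law \<Omega> P) \<and>
     mult_law (gamma_law (1 + \<theta>)) (X_half_param_law \<theta>) =
       mult_law (gamma_law (\<theta> + 1/2)) (X_half_param_law (\<theta> + 1/2)) \<and>
     (\<forall>(\<Omega> :: 'a measure) P.
        dirichlet_process \<Omega> P (\<theta> + 1) (XY_law ((\<theta> + 1/2) / (1 + \<theta>))) \<longrightarrow>
        mult_law (gamma_law (1 + \<theta>)) (X_half_param_law \<theta>) = GGC_law (\<theta> + 1) \<Omega> P) \<and>
     (\<forall>(\<Omega> :: 'b measure) Q.
        dirichlet_process \<Omega> Q (\<theta> + 1/2) X_half_law \<longrightarrow>
        dirichlet_mean_finite \<Omega> Q \<and>
        mult_law (gamma_law (1 + \<theta>)) (X_half_param_law \<theta>) = GGC_law (\<theta> + 1/2) \<Omega> Q) \<and>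
     (\<forall>(\<Omega> :: 'a measure) P (\<Omega>' :: 'b measure) Q.
        dirichlet_process \<Omega> P (\<theta> + 1) (XY_law ((\<theta> + 1/2) / (1 + \<theta>))) \<and>
        dirichlet_process \<Omega>' Q (\<theta> + 1/2) X_half_law \<longrightarrow>
        GGC_law (\<theta> + 1) \<Omega> P = GGC_law (\<theta> + 1/2) \<Omega>' Q)"
proof -
  define a where "a = \<theta> + 1/2"
  define p where "p = (\<theta> + 1/2) / (1 + \<theta>)"
  have a: "a > 0" "1 + \<theta> = a + 1/2" "\<theta> + 1 = a + 1/2" "\<theta> + 1/2 + 1/2 = a + 1/2"
    using assms by (simp_all add: a_def)
  have p: "0 \<le> p" "p \<le> 1" "(a + 1/2) * p = a"
    using assms by (simp_all add: p_def a_def field_simps)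
  have X_eq: "X_half_param_law \<theta> = ratio_law (gamma_law a) (gamma_law (1/2))"
      "X_half_param_law (\<theta> + 1/2) = ratio_law (gamma_law (a + 1/2)) (gamma_law (1/2))"
    unfolding X_half_param_law_def a_def by (rule refl)+
  let ?X = "X_half_param_law \<theta>" and ?Z = "mult_law (gamma_law (a + 1/2)) (X_half_param_law \<theta>)"
  have X: "prob_space ?X" "sets ?X = sets borel" "AE x in ?X. 0 \<le> x"
    unfolding X_eq by (simp_all add: prob_space_ratio_law AE_ratio_law_nonneg AE_gamma_law_nonneg)
  have X_stieltjes: "(\<integral>\<^sup>+x. ennreal ((1 + l * x) powr (- (a + 1/2))) \<partial>?X) = ennreal ((1 + sqrt l) powr (- (2 * a)))" if "l \<ge> 0" for l
    using gamma_ratio_half_stieltjes[OF a(1), of "sqrt l"] that unfolding X_eq by simp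
  have beta: "?X = mult_law (beta_law (\<theta> + 1/2) (1/2)) (X_half_param_law (\<theta> + 1/2))"
  proof -
    have "?X = ratio_law (mult_law (beta_law a (1/2)) (gamma_law (a + 1/2))) (gamma_law (1/2))"
      unfolding X_eq using a(1) by (simp add: beta_gamma_product)
    also have "\<dots> = mult_law (beta_law a (1/2)) (X_half_param_law (\<theta> + 1/2))"
      unfolding X_eq using a(1) by (intro ratio_law_mult_law) (simp_all add: prob_space_beta_law)
    finally show ?thesis unfolding a_def .
  qed
  have swap: "?Z = mult_law (gamma_law a) (X_half_param_law (\<theta> + 1/2))"
  proof -
    have "?Z = ratio_law (mult_law (gamma_law (a + 1/2)) (gamma_law a)) (gamma_law (1/2))"
      unfolding X_eq by (rule ratio_law_mult_law[symmetric]) simp_all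
    also have "mult_law (gamma_law (a + 1/2)) (gamma_law a) = mult_law (gamma_law a) (gamma_law (a + 1/2))"
      by (rule mult_law_commute) simp_all
    also have "ratio_law \<dots> (gamma_law (1/2)) = mult_law (gamma_law a) (X_half_param_law (\<theta> + 1/2))"
      unfolding X_eq by (rule ratio_law_mult_law) simp_all
    finally show ?thesis .
  qed
  have P: "dirichlet_mean_finite \<Omega> P \<and> ?X = dirichlet_mean_law \<Omega> P"
    if DP: "dirichlet_process \<Omega> P (a + 1/2) (XY_law p)" for \<Omega> :: "'a measure" and P
  proof
    have pos: "a + 1/2 > 0" using a by simp
    have log: "\<forall>r\<ge>0. (\<integral>\<^sup>+x. ennreal (ln (1 + r\<^sup>2 * x)) \<partial>XY_law p) = ennreal (p * (2 * ln (1 + r)))"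
      using XY_law_log_moment p(1,2) by blast
    note M = dirichlet_mean_of_log_moment[OF DP prob_space_XY_law sets_XY_law AE_XY_law_nonneg pos p(1) log]
    show "dirichlet_mean_finite \<Omega> P" by (rule M(1))
    show "?X = dirichlet_mean_law \<Omega> P"
    proof (rule stieltjes_transform_determines_law[OF X M(2-4) pos])
      fix l :: real assume "l > 0"
      then show "(\<integral>\<^sup>+y. ennreal ((1 + l * y) powr (- (a + 1/2))) \<partial>?X)
        = (\<integral>\<^sup>+y. ennreal ((1 + l * y) powr (- (a + 1/2))) \<partial>dirichlet_mean_law \<Omega> P)"
        unfolding M(5)[OF \<open>l > 0\<close>] p(3) by (intro X_stieltjes) simp
    qed
  qed
  have Q: "dirichlet_mean_finite \<Omega> Q \<and> ?Z = GGC_law a \<Omega> Q"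
    if DP: "dirichlet_process \<Omega> Q a X_half_law" for \<Omega> :: "'b measure" and Q
  proof
    have log: "\<forall>r\<ge>0. (\<integral>\<^sup>+x. ennreal (ln (1 + r\<^sup>2 * x)) \<partial>X_half_law) = ennreal (1 * (2 * ln (1 + r)))"
      by (simp add: X_half_law_log_moment)
    note M = dirichlet_mean_of_log_moment[OF DP prob_space_X_half_law sets_X_half_law AE_X_half_law_nonneg a(1) zero_le_one log]
    show "dirichlet_mean_finite \<Omega> Q" by (rule M(1))
    show "?Z = GGC_law a \<Omega> Q"
      unfolding GGC_law_def
    proof (rule laplace_transform_determines_measure)
      fix n :: nat
      have *: "(\<integral>\<^sup>+y. ennreal ((1 + real n * y) powr (- (a + 1/2))) \<partial>?X)
        = (\<integral>\<^sup>+y. ennreal ((1 + real n * y) powr (- a)) \<partial>dirichlet_mean_law \<Omega> Q)"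
      proof (cases "n = 0")
        case True
        then show ?thesis using X(1) M(2) by (simp add: prob_space.emeasure_space_1)
      next
        case False
        then show ?thesis using M(5)[of "real n"] X_stieltjes[of "real n"] by simp
      qed
      show "(\<integral>\<^sup>+x. ennreal (exp (- real n * x)) \<partial>?Z) = (\<integral>\<^sup>+x. ennreal (exp (- real n * x)) \<partial>mult_law (gamma_law a) (dirichlet_mean_law \<Omega> Q))"
        using laplace_transform_gamma_mixture[OF X, of "a + 1/2" "real n"]
          laplace_transform_gamma_mixture[OF M(2-4) a(1), of "real n"] a(1) * by simp
      show "finite_measure ?Z" "finite_measure (mult_law (gamma_law a) (dirichlet_mean_law \<Omega> Q))"
        by (intro prob_space.finite_measure prob_space_mult_law; simp add: X M)+
      show "AE x in ?Z. 0 \<le> x" "AE x in mult_law (gamma_law a) (dirichlet_mean_law \<Omega> Q). 0 \<le> x"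
        by (intro AE_mult_law_nonneg; simp add: X M AE_gamma_law_nonneg)+
    qed simp_all
  qed
  have P_GGC: "?Z = GGC_law (a + 1/2) \<Omega> P"
    if "dirichlet_process \<Omega> P (a + 1/2) (XY_law p)" for \<Omega> :: "'a measure" and P
    unfolding GGC_law_def using P[OF that] by simp
  note restated = P[unfolded p_def, folded a(2), unfolded a_def] P_GGC[unfolded p_def, folded a(2), unfolded a_def]
    Q[folded a(2), unfolded a_def] swap[folded a(2), unfolded a_def]
  show ?thesis
    unfolding add.commute[of \<theta> 1]
  proof (intro conjI allI impI)
    show "?X = mult_law (beta_law (\<theta> + 1/2) (1/2)) (X_half_param_law (\<theta> + 1/2))"
      by (rule beta)
    show "mult_law (gamma_law (1 + \<theta>)) ?X = mult_law (gamma_law (\<theta> + 1/2)) (X_half_param_law (\<theta> + 1/2))"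
      by (rule restated(4))
  next
    fix \<Omega> :: "'a measure" and P
    assume DP: "dirichlet_process \<Omega> P (1 + \<theta>) (XY_law ((\<theta> + 1/2) / (1 + \<theta>)))"
    show "dirichlet_mean_finite \<Omega> P" "?X = dirichlet_mean_law \<Omega> P"
      using restated(1)[OF DP] by blast+
    show "mult_law (gamma_law (1 + \<theta>)) ?X = GGC_law (1 + \<theta>) \<Omega> P"
      by (rule restated(2)[OF DP])
  next
    fix \<Omega> :: "'b measure" and Q
    assume DP: "dirichlet_process \<Omega> Q (\<theta> + 1/2) X_half_law"
    show "dirichlet_mean_finite \<Omega> Q" "mult_law (gamma_law (1 + \<theta>)) ?X = GGC_law (\<theta> + 1/2) \<Omega> Q"
      using restated(3)[OF DP] by blast+
  next
    fix \<Omega> :: "'a measure" and P and \<Omega>' :: "'b measure" and Q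
    assume "dirichlet_process \<Omega> P (1 + \<theta>) (XY_law ((\<theta> + 1/2) / (1 + \<theta>))) \<and>
      dirichlet_process \<Omega>' Q (\<theta> + 1/2) X_half_law"
    then show "GGC_law (1 + \<theta>) \<Omega> P = GGC_law (\<theta> + 1/2) \<Omega>' Q"
      using restated(2)[of \<Omega> P] restated(3)[of \<Omega>' Q] by simp
  qed
qed

end
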